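(* For every $k \ge 2$ there is a constant $t$ such that there exist a density $\alpha > 0$ and an on-line strategy for the $t$-choice $k$-SAT Achlioptas process such that, with $m = \lfloor \alpha n \rfloor$, the uniformly random formula $F_k(n,m)$ is satisfiable with probability tending to $1$ as $n \to \infty$, while the formula produced by the strategy is unsatisfiable with probability tending to $1$ as $n\to\infty$. Moreover, there is $k_0$ such that for all $k \ge k_0$ this holds with $t = 2$.
   Context: Fix $n$ Boolean variables $x_1,\dots,x_n$. A $k$-clause is a disjunction of $k$ literals on $k$ distinct variables; there are $2^k\binom{n}{k}$ of them. The random formula $F_k(n,m)$ is the conjunction of $m$ clauses, each chosen independently and uniformly from these $2^k\binom{n}{k}$ clauses. In the $t$-choice Achlioptas process for $k$-SAT, for each step $i = 1,\dots,m$ one is presented with $t$ independent, uniformly random $k$-clauses; a strategy selects one of them (its choice may depend on all clauses presented and selected at earlier steps and on the current $t$ clauses, but not on future ones) and adds it to the formula, discarding the others. After $m$ steps the result is a $k$-SAT formula with $m$ clauses on the variables $x_1,\dots,x_n$. *)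

theory Defs
  imports "HOL-Probability.Probability"
begin

type_synonym lit = "nat \<times> bool"
type_synonym clause = "lit set"
type_synonym formula = "clause list"

text \<open>
  The variables are \<open>0, \<dots>, n - 1\<close>; the literal \<open>(v, True)\<close> is the variable \<open>v\<close> and
  \<open>(v, False)\<close> its negation. Formulas are lists since clauses are drawn with replacement.
\<close>

definition k_clauses :: "nat \<Rightarrow> nat \<Rightarrow> clause set" where
  "k_clauses n k = {C. C \<subseteq> {..<n} \<times> UNIV \<and> card C = k \<and> inj_on fst C}"

definition satisfiable :: "formula \<Rightarrow> bool" where
  "satisfiable F \<longleftrightarrow> (\<exists>\<sigma> :: nat \<Rightarrow> bool. \<forall>C \<in> set F. \<exists>(v, b) \<in> C. \<sigma> v = b)"

text \<open>
  For \<open>n < k\<close> there are no \<open>k\<close>-clauses and \<open>pmf_of_set (k_clauses n k)\<close> is unspecified;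
  only limits as \<open>n\<close> tends to infinity are considered.
\<close>

definition random_formula :: "nat \<Rightarrow> nat \<Rightarrow> nat \<Rightarrow> formula pmf" where
  "random_formula k n m = replicate_pmf m (pmf_of_set (k_clauses n k))"

text \<open>
  A history records, for each earlier step in order, the offered clauses and the selected one.
  A strategy maps the history and the currently offered clauses to the clause it selects.
\<close>

type_synonym history = "(clause list \<times> clause) list"
type_synonym strategy = "history \<Rightarrow> clause list \<Rightarrow> clause"

definition is_strategy :: "nat \<Rightarrow> strategy \<Rightarrow> bool" where
  "is_strategy t S \<longleftrightarrow> (\<forall>h cs. length cs = t \<longrightarrow> S h cs \<in> set cs)"

primrec achlioptas_history :: "nat \<Rightarrow> nat \<Rightarrow> nat \<Rightarrow> strategy \<Rightarrow> nat \<Rightarrow> history pmf" where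
  "achlioptas_history t k n S 0 = return_pmf []"
| "achlioptas_history t k n S (Suc i) =
     bind_pmf (achlioptas_history t k n S i) (\<lambda>h.
     bind_pmf (replicate_pmf t (pmf_of_set (k_clauses n k))) (\<lambda>cs.
     return_pmf (h @ [(cs, S h cs)])))"

definition achlioptas_formula :: "nat \<Rightarrow> nat \<Rightarrow> nat \<Rightarrow> strategy \<Rightarrow> nat \<Rightarrow> formula pmf" where
  "achlioptas_formula t k n S m = map_pmf (map snd) (achlioptas_history t k n S m)"

text \<open>
  The strategy may depend on \<open>n\<close>, and hence on the number of steps, which \<open>n\<close> and \<open>\<alpha>\<close> determine.
\<close>

definition threshold_lowerable :: "nat \<Rightarrow> nat \<Rightarrow> bool" where
  "threshold_lowerable k t \<longleftrightarrow>
     (\<exists>(\<alpha>::real) (S :: nat \<Rightarrow> strategy). \<alpha> > 0 \<and> (\<forall>n. is_strategy t (S n)) \<and>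
        (\<lambda>n. measure_pmf.prob (random_formula k n (nat \<lfloor>\<alpha> * real n\<rfloor>))
               {F. satisfiable F}) \<longlonglongrightarrow> 1 \<and>
        (\<lambda>n. measure_pmf.prob (achlioptas_formula t k n (S n) (nat \<lfloor>\<alpha> * real n\<rfloor>))
               {F. \<not> satisfiable F}) \<longlonglongrightarrow> 1)"

lemma finite_k_clauses: "finite (k_clauses n k)"
proof (rule finite_subset)
  show "k_clauses n k \<subseteq> Pow ({..<n} \<times> UNIV)" by (auto simp: k_clauses_def)
qed auto

lemma card_k_clauses: "card (k_clauses n k) = 2 ^ k * (n choose k)"
proof -
  define A where "A = Sigma {V. V \<subseteq> {..<n} \<and> card V = k} Pow"
  define f where "f = (\<lambda>(V, T). (\<lambda>v::nat. (v, v \<in> T)) ` V)"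
  define g where "g = (\<lambda>C::clause. (fst ` C, {v. (v, True) \<in> C}))"
  have "bij_betw f A (k_clauses n k)"
  proof (rule bij_betw_byWitness[where f' = g])
    show "\<forall>a\<in>A. g (f a) = a"
      by (auto simp: A_def f_def g_def image_image)
    show "\<forall>C\<in>k_clauses n k. f (g C) = C"
    proof
      fix C assume C: "C \<in> k_clauses n k"
      have eq: "(v, (v, True) \<in> C) = (v, b)" if "(v, b) \<in> C" for v b
        using C that by (cases b) (force simp: k_clauses_def inj_on_def)+
      have "f (g C) = (\<lambda>c. (fst c, (fst c, True) \<in> C)) ` C"
        by (simp add: f_def g_def image_image)
      also have "\<dots> = (\<lambda>c. c) ` C"
        by (rule image_cong) (use eq in auto)
      finally show "f (g C) = C" by simp
    qed
    show "f ` A \<subseteq> k_clauses n k"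
      by (auto simp: A_def f_def k_clauses_def inj_on_def card_image)
    show "g ` k_clauses n k \<subseteq> A"
      by (force simp: A_def g_def k_clauses_def card_image)
  qed
  hence "card (k_clauses n k) = card A"
    by (simp add: bij_betw_same_card)
  also have "\<dots> = (\<Sum>V | V \<subseteq> {..<n} \<and> card V = k. card (Pow V))"
    unfolding A_def by (rule card_SigmaI) (auto intro: finite_subset)
  also have "\<dots> = (\<Sum>V | V \<subseteq> {..<n} \<and> card V = k. 2 ^ k)"
    by (rule sum.cong) (auto simp: card_Pow finite_subset)
  also have "\<dots> = 2 ^ k * (n choose k)"
    by (simp add: n_subsets)
  finally show ?thesis .
qed

end

theory Submission
  imports Defs "HOL-Real_Asymp.Real_Asymp"
begin

text \<open>
  Lowering the threshold. Fix the first \<open>N = (1 - \<beta>) n\<close> variables and let the strategy select an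
  offered clause lying inside them whenever there is one. A selected clause inside is uniform among
  the inside clauses, so a first moment over the \<open>2 ^ N\<close> assignments of these variables refutes the
  formula as soon as \<open>\<alpha> (1 - (1 - q) ^ t) > (1 - \<beta>) 2 ^ k ln 2\<close>, where \<open>q \<approx> (1 - \<beta>) ^ k\<close> is the
  probability that one clause lies inside. With many choices one may take \<open>N = \<epsilon> n\<close> for tiny \<open>\<epsilon>\<close>,
  so that \<open>\<alpha> = 1/18\<close> suffices; there a first moment over Hall violators (sets of \<open>j\<close> clauses on fewer
  than \<open>j\<close> variables) shows that the random formula is satisfiable. With two choices
  \<open>\<beta> = 1 / (2 k\<^sup>2)\<close> gains a factor \<open>1 - \<Theta>(1 / k\<^sup>2)\<close> over \<open>2 ^ k ln 2\<close>.

  Satisfiability just below \<open>2 ^ k ln 2\<close>. Count assignments with a signed weight per clause: if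
  \<open>y\<^sub>l = 1\<close> for a false literal and \<open>-1\<close> for a true one, the weight is \<open>1\<close> minus the average of
  \<open>\<Prod>l\<in>S. y\<^sub>l\<close> over all sets \<open>S\<close> of at least three literals of the clause. It vanishes on violated clauses, so a
  nonzero total weight certifies satisfiability. As it has no Fourier coefficients of degree one
  and two, the correlation of two assignments of overlap \<open>\<rho>\<close> deviates from \<open>1\<close> only at order \<open>\<rho> ^ 3\<close>,
  and the second moment is asymptotically the square of the first. Chebyshev's inequality then gives
  satisfiability with probability tending to \<open>1\<close> directly, without a sharp threshold theorem.
\<close>

section \<open>The strategy and the first moment\<close>

lemma expectation_bind_pmf_finite:
  fixes h :: "'b \<Rightarrow> real"
  assumes "finite (set_pmf p)" "\<And>x. x \<in> set_pmf p \<Longrightarrow> finite (set_pmf (f x))"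
  shows "measure_pmf.expectation (bind_pmf p f) h =
         measure_pmf.expectation p (\<lambda>x. measure_pmf.expectation (f x) h)"
  using assms
  by (subst pmf_expectation_bind[of "set_pmf p"]) (auto simp: integral_measure_pmf[of "set_pmf p"])

lemma prob_eq_expectation:
  "measure_pmf.prob p A = measure_pmf.expectation p (\<lambda>x. of_bool (x \<in> A))"
proof -
  have "(\<lambda>x. of_bool (x \<in> A)) = (indicator A :: _ \<Rightarrow> real)"
    by (auto simp: indicator_def)
  thus ?thesis by simp
qed

lemma finite_set_replicate_pmf:
  assumes "finite (set_pmf p)"
  shows "finite (set_pmf (replicate_pmf m p))"
proof -
  have "set_pmf (replicate_pmf m p) = {xs. set xs \<subseteq> set_pmf p \<and> length xs = m}"
    by (auto simp: set_replicate_pmf)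
  thus ?thesis using finite_lists_length_eq[OF assms] by simp
qed

text \<open>Independence of the draws. The factors may depend on the position, so that positions
  outside a chosen set can carry the factor one.\<close>

lemma expectation_replicate_pmf_prod:
  fixes f :: "nat \<Rightarrow> 'a \<Rightarrow> real"
  assumes "finite (set_pmf p)"
  shows "measure_pmf.expectation (replicate_pmf m p) (\<lambda>xs. \<Prod>i<m. f i (xs ! i)) =
         (\<Prod>i<m. measure_pmf.expectation p (f i))"
proof (induction m arbitrary: f)
  case (Suc m)
  have "measure_pmf.expectation (replicate_pmf (Suc m) p) (\<lambda>xs. \<Prod>i<Suc m. f i (xs ! i)) =
        measure_pmf.expectation p (\<lambda>x. measure_pmf.expectation (replicate_pmf m p)
          (\<lambda>xs. \<Prod>i<Suc m. f i ((x # xs) ! i)))"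
    using assms finite_set_replicate_pmf[OF assms, of m]
    by (simp add: expectation_bind_pmf_finite del: prod.lessThan_Suc)
  also have "\<dots> = measure_pmf.expectation p (\<lambda>x. f 0 x * measure_pmf.expectation (replicate_pmf m p)
          (\<lambda>xs. \<Prod>i<m. f (Suc i) (xs ! i)))"
    by (simp add: prod.lessThan_Suc_shift del: prod.lessThan_Suc)
  also have "\<dots> = (\<Prod>i<Suc m. measure_pmf.expectation p (f i))"
    by (simp add: prod.lessThan_Suc_shift Suc.IH[of "\<lambda>i. f (Suc i)"] del: prod.lessThan_Suc)
  finally show ?case .
qed simp

lemma length_replicate_pmf: "xs \<in> set_pmf (replicate_pmf m p) \<Longrightarrow> length xs = m"
  by (simp add: set_replicate_pmf)

text \<open>The first draw satisfying \<open>P\<close>, if there is one, has the law of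
  \<open>p\<close> conditioned on \<open>P\<close>. Both sides carry the probability of
  \<open>P\<close> as a factor, so that no conditional probability has to be formed.\<close>

lemma prob_find_replicate_pmf:
  assumes "finite (set_pmf p)"
  shows "measure_pmf.prob p {x. P x} *
           measure_pmf.prob (replicate_pmf t p) {xs. \<exists>x. find P xs = Some x \<and> Q x} =
         measure_pmf.prob p {x. P x \<and> Q x} * (1 - (1 - measure_pmf.prob p {x. P x}) ^ t)"
proof (induction t)
  case (Suc t)
  define q where "q = measure_pmf.prob p {x. P x}"
  define b where "b = (\<lambda>t. measure_pmf.prob (replicate_pmf t p) {xs. \<exists>x. find P xs = Some x \<and> Q x})"
  have int: "integrable (measure_pmf p) f" for f :: "'a \<Rightarrow> real"
    by (rule integrable_measure_pmf_finite[OF assms])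
  have "b (Suc t) = measure_pmf.expectation p (\<lambda>x. measure_pmf.expectation (replicate_pmf t p)
          (\<lambda>xs. of_bool (\<exists>y. find P (x # xs) = Some y \<and> Q y)))"
    unfolding b_def prob_eq_expectation
    using assms finite_set_replicate_pmf[OF assms, of t]
    by (simp add: expectation_bind_pmf_finite)
  \<comment> \<open>Either the first draw already satisfies \<open>P\<close>, or the search
    continues among the other \<open>t\<close> draws.\<close>
  also have "\<dots> = measure_pmf.expectation p
          (\<lambda>x. of_bool (x \<in> {x. P x \<and> Q x}) + b t * (1 - of_bool (x \<in> {x. P x})))"
  proof (rule Bochner_Integration.integral_cong[OF refl])
    fix x
    have "b t = measure_pmf.expectation (replicate_pmf t p) (\<lambda>xs. of_bool (\<exists>y. find P xs = Some y \<and> Q y))"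
      by (simp only: b_def prob_eq_expectation mem_Collect_eq)
    thus "measure_pmf.expectation (replicate_pmf t p) (\<lambda>xs. of_bool (\<exists>y. find P (x # xs) = Some y \<and> Q y)) =
        of_bool (x \<in> {x. P x \<and> Q x}) + b t * (1 - of_bool (x \<in> {x. P x}))"
      by (cases "P x") simp_all
  qed
  also have "\<dots> = measure_pmf.prob p {x. P x \<and> Q x} + b t * (1 - q)"
    unfolding q_def prob_eq_expectation by (simp add: int)
  finally have "q * b (Suc t) = q * measure_pmf.prob p {x. P x \<and> Q x} + (1 - q) * (q * b t)"
    by (simp only:) (simp add: algebra_simps)
  moreover have "q * b t = measure_pmf.prob p {x. P x \<and> Q x} * (1 - (1 - q) ^ t)"
    using Suc.IH by (simp only: q_def b_def)
  ultimately have "q * b (Suc t) = measure_pmf.prob p {x. P x \<and> Q x} * (1 - (1 - q) ^ Suc t)"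
    by (simp only: power_Suc) (simp add: algebra_simps)
  thus ?case by (simp only: q_def b_def)
qed simp

lemma finite_achlioptas_history:
  assumes "k_clauses n k \<noteq> {}"
  shows "finite (set_pmf (achlioptas_history t k n S i))"
  using assms finite_set_replicate_pmf[of "pmf_of_set (k_clauses n k)" t]
  by (induction i) (auto simp: finite_k_clauses)

lemma k_clauses_nonempty:
  assumes "k \<le> n"
  shows "k_clauses n k \<noteq> {}"
proof -
  have "card (k_clauses n k) > 0" using assms by (simp add: card_k_clauses)
  thus ?thesis by force
qed

text \<open>A strategy that ignores the history selects independent, identically distributed
  clauses, so the probabilities of the steps multiply.\<close>

lemma prob_history_all:
  assumes "k_clauses n k \<noteq> {}"
  shows "measure_pmf.prob (achlioptas_history t k n (\<lambda>_. s) i) {h. \<forall>x\<in>set h. R (snd x)} =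
         measure_pmf.prob (replicate_pmf t (pmf_of_set (k_clauses n k))) {cs. R (s cs)} ^ i"
proof (induction i)
  case (Suc i)
  let ?U = "replicate_pmf t (pmf_of_set (k_clauses n k))"
  let ?H = "achlioptas_history t k n (\<lambda>_. s) i"
  have fin: "finite (set_pmf ?U)"
    by (rule finite_set_replicate_pmf) (use assms in \<open>simp add: finite_k_clauses\<close>)
  have "measure_pmf.prob (achlioptas_history t k n (\<lambda>_. s) (Suc i)) {h. \<forall>x\<in>set h. R (snd x)} =
     measure_pmf.expectation ?H (\<lambda>h. measure_pmf.expectation ?U
        (\<lambda>cs. of_bool (\<forall>x\<in>set h. R (snd x)) * of_bool (R (s cs))))"
    unfolding prob_eq_expectation using fin finite_achlioptas_history[OF assms]
    by (simp add: expectation_bind_pmf_finite) (simp add: of_bool_conj conj_commute mult.commute)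
  also have "\<dots> = measure_pmf.prob ?H {h. \<forall>x\<in>set h. R (snd x)} * measure_pmf.prob ?U {cs. R (s cs)}"
    by (simp add: prob_eq_expectation)
  finally show ?case using Suc.IH by simp
qed simp

section \<open>Uniform clauses as variables with signs\<close>

text \<open>Separates the variables of a clause from its signs: a uniform clause is a uniform
  \<open>k\<close>-set \<open>V\<close> followed by a uniform \<open>T\<close> in
  \<open>Pow V\<close>, and averages over signs can be taken with \<open>V\<close> fixed.\<close>

definition signed_clause :: "nat set \<Rightarrow> nat set \<Rightarrow> clause" where
  "signed_clause V T = (\<lambda>v. (v, v \<in> T)) ` V"

lemma bij_betw_signed_clause:
  "bij_betw (\<lambda>(V, T). signed_clause V T)
     (SIGMA V:{V. V \<subseteq> {..<n} \<and> card V = k}. Pow V) (k_clauses n k)"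
proof (rule bij_betw_byWitness[where f' = "\<lambda>C. (fst ` C, {v. (v, True) \<in> C})"])
  show "\<forall>C\<in>k_clauses n k. (\<lambda>(V, T). signed_clause V T) (fst ` C, {v. (v, True) \<in> C}) = C"
  proof
    fix C assume C: "C \<in> k_clauses n k"
    have eq: "(v, (v, True) \<in> C) = (v, b)" if "(v, b) \<in> C" for v b
      using C that by (cases b) (force simp: k_clauses_def inj_on_def)+
    have "(\<lambda>c. (fst c, (fst c, True) \<in> C)) ` C = (\<lambda>c. c) ` C"
      by (rule image_cong) (use eq in auto)
    thus "(\<lambda>(V, T). signed_clause V T) (fst ` C, {v. (v, True) \<in> C}) = C"
      by (simp add: signed_clause_def image_image)
  qed
qed (auto simp: signed_clause_def image_image k_clauses_def inj_on_def card_image,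
     (force simp: card_image inj_on_def)?)

lemma expectation_clause:
  fixes f :: "clause \<Rightarrow> real"
  assumes "k \<le> n"
  shows "measure_pmf.expectation (pmf_of_set (k_clauses n k)) f =
         (\<Sum>V | V \<subseteq> {..<n} \<and> card V = k. (\<Sum>T\<in>Pow V. f (signed_clause V T)) / 2 ^ k) / real (n choose k)"
proof -
  let ?A = "{V. V \<subseteq> {..<n} \<and> card V = k}"
  have fin: "finite V" if "V \<in> ?A" for V using that finite_subset by auto
  have "sum f (k_clauses n k) = (\<Sum>(V, T)\<in>(SIGMA V:?A. Pow V). f (signed_clause V T))"
    using sum.reindex_bij_betw[OF bij_betw_signed_clause, of f n k] by (simp add: case_prod_unfold)
  also have "\<dots> = (\<Sum>V\<in>?A. \<Sum>T\<in>Pow V. f (signed_clause V T))"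
    by (rule sum.Sigma[symmetric]) (use fin in auto)
  finally show ?thesis using assms
    by (simp add: integral_pmf_of_set k_clauses_nonempty finite_k_clauses card_k_clauses
        sum_divide_distrib)
qed

text \<open>An assignment is encoded as the set of its true variables, so that the assignments of
  the first \<open>N\<close> variables are the members of \<open>Pow {..<N}\<close>.\<close>

definition violates :: "nat set \<Rightarrow> clause \<Rightarrow> bool" where
  "violates A C \<longleftrightarrow> (\<forall>(v, b)\<in>C. (v \<in> A) \<noteq> b)"

text \<open>If no offered clause lies inside, the choice is irrelevant, as only the inside clauses are used.\<close>

definition choose_inside :: "nat \<Rightarrow> clause list \<Rightarrow> clause" where
  "choose_inside N cs = (case find (\<lambda>C. C \<subseteq> {..<N} \<times> UNIV) cs of Some C \<Rightarrow> C | None \<Rightarrow> hd cs)"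

lemma is_strategy_choose_inside:
  assumes "t > 0"
  shows "is_strategy t (\<lambda>_. choose_inside N)"
  using assms unfolding is_strategy_def choose_inside_def
  by (auto split: option.split simp: find_Some_iff)

text \<open>If the search fails, no offered clause is inside, hence neither is the head that is
  selected by default. So the selection is inside exactly when the search succeeds.\<close>

lemma find_choose_inside:
  assumes "cs \<noteq> []"
  shows "(choose_inside N cs \<subseteq> {..<N} \<times> UNIV \<and> Q (choose_inside N cs)) \<longleftrightarrow>
         (\<exists>C. find (\<lambda>C. C \<subseteq> {..<N} \<times> UNIV) cs = Some C \<and> Q C)"
proof (cases "find (\<lambda>C. C \<subseteq> {..<N} \<times> UNIV) cs")
  case None
  hence "\<not> hd cs \<subseteq> {..<N} \<times> UNIV" using assms by (auto simp: find_None_iff)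
  thus ?thesis using None by (simp add: choose_inside_def)
next
  case (Some C)
  hence "C \<subseteq> {..<N} \<times> UNIV" by (auto simp: find_Some_iff)
  thus ?thesis using Some by (auto simp: choose_inside_def)
qed

text \<open>The assignment forces the sign of every literal of a violated clause, so such a clause
  is determined by its variables.\<close>

lemma card_violated_clauses:
  "card {C \<in> k_clauses n k. violates A C} = n choose k"
proof -
  have "bij_betw (\<lambda>V. (\<lambda>v. (v, v \<notin> A)) ` V) {V. V \<subseteq> {..<n} \<and> card V = k} {C \<in> k_clauses n k. violates A C}"
  proof (rule bij_betw_byWitness[where f' = "\<lambda>C. fst ` C"])
    show "\<forall>C\<in>{C \<in> k_clauses n k. violates A C}. (\<lambda>v. (v, v \<notin> A)) ` fst ` C = C"
    proof safe
      fix C v b assume C: "C \<in> k_clauses n k" "violates A C" and vb: "(v, b) \<in> C"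
      have "b = (v \<notin> A)" using C(2) vb by (auto simp: violates_def)
      thus "(fst (v, b), fst (v, b) \<notin> A) \<in> C" using vb by simp
      show "(v, b) \<in> (\<lambda>v. (v, v \<notin> A)) ` fst ` C"
        using \<open>b = (v \<notin> A)\<close> vb by force
    qed
  qed (auto simp: image_image k_clauses_def inj_on_def card_image violates_def, (force simp: card_image inj_on_def)?)
  hence "card {C \<in> k_clauses n k. violates A C} = card {V. V \<subseteq> {..<n} \<and> card V = k}"
    by (simp add: bij_betw_same_card)
  thus ?thesis by (simp add: n_subsets)
qed

lemma prob_clause_subset:
  assumes "W \<subseteq> {..<n}" "k \<le> n"
  shows "measure_pmf.prob (pmf_of_set (k_clauses n k)) {C. C \<subseteq> W \<times> UNIV} =
         real (card W choose k) / real (n choose k)"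
proof -
  let ?A = "{V. V \<subseteq> {..<n} \<and> card V = k}"
  have fin: "finite V" if "V \<in> ?A" for V using that finite_subset by auto
  have "measure_pmf.prob (pmf_of_set (k_clauses n k)) {C. C \<subseteq> W \<times> UNIV} =
        (\<Sum>V\<in>?A. (\<Sum>T\<in>Pow V. of_bool (V \<subseteq> W)) / 2 ^ k) / real (n choose k)"
  proof -
    have "signed_clause V T \<subseteq> W \<times> UNIV \<longleftrightarrow> V \<subseteq> W" for V T by (auto simp: signed_clause_def)
    thus ?thesis by (simp add: prob_eq_expectation expectation_clause[OF assms(2)])
  qed
  also have "(\<Sum>V\<in>?A. (\<Sum>T\<in>Pow V. of_bool (V \<subseteq> W)) / 2 ^ k) = (\<Sum>V\<in>?A. of_bool (V \<subseteq> W) :: real)"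
  proof (rule sum.cong[OF refl])
    fix V assume V: "V \<in> ?A"
    have "card (Pow V) = 2 ^ k" using fin[OF V] V by (simp add: card_Pow)
    thus "(\<Sum>T\<in>Pow V. of_bool (V \<subseteq> W)) / 2 ^ k = (of_bool (V \<subseteq> W) :: real)" by simp
  qed
  also have "\<dots> = real (card (?A \<inter> {V. V \<subseteq> W}))"
    by (subst sum_of_bool_eq) auto
  also have "?A \<inter> {V. V \<subseteq> W} = {V. V \<subseteq> W \<and> card V = k}" using assms(1) by auto
  also have "card \<dots> = card W choose k"
    by (rule n_subsets) (use assms(1) finite_subset in auto)
  finally show ?thesis .
qed

lemma prob_clause_inside_violated:
  assumes "N \<le> n" "k \<le> n"
  shows "measure_pmf.prob (pmf_of_set (k_clauses n k)) {C. C \<subseteq> {..<N} \<times> UNIV \<and> violates A C} =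
         real (N choose k) / (2 ^ k * real (n choose k))"
proof -
  have "k_clauses n k \<inter> {C. C \<subseteq> {..<N} \<times> UNIV \<and> violates A C} = {C \<in> k_clauses N k. violates A C}"
    using assms(1) by (auto simp: k_clauses_def)
  thus ?thesis using assms
    by (simp add: measure_pmf_of_set finite_k_clauses k_clauses_nonempty card_violated_clauses
      card_k_clauses)
qed

lemma satisfiable_imp_violates:
  assumes "satisfiable F"
  shows "\<exists>A\<in>Pow {..<N}. \<forall>C\<in>set F. \<not> (C \<subseteq> {..<N} \<times> UNIV \<and> violates A C)"
proof -
  obtain \<sigma> where \<sigma>: "\<And>C. C \<in> set F \<Longrightarrow> \<exists>(v, b) \<in> C. \<sigma> v = b"
    using assms by (auto simp: satisfiable_def)
  show ?thesis
    by (rule bexI[of _ "{v. v < N \<and> \<sigma> v}"]) (use \<sigma> in \<open>fastforce simp: violates_def\<close>)+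
qed

text \<open>Union bound over the assignments of the first \<open>N\<close> variables. In each step
  an inside clause is offered with probability \<open>1 - (1 - q) ^ t\<close>, and the selected one,
  being uniform among the inside clauses, is violated with probability
  \<open>1 / 2 ^ k\<close>.\<close>

lemma prob_achlioptas_satisfiable_le:
  assumes "k \<le> N" "N \<le> n" "t > 0"
  defines "q \<equiv> real (N choose k) / real (n choose k)"
  shows "measure_pmf.prob (achlioptas_formula t k n (\<lambda>_. choose_inside N) m) {F. satisfiable F} \<le>
         2 ^ N * (1 - (1 - (1 - q) ^ t) / 2 ^ k) ^ m"
proof -
  let ?U = "pmf_of_set (k_clauses n k)"
  let ?H = "achlioptas_history t k n (\<lambda>_. choose_inside N) m"
  let ?R = "\<lambda>A C. \<not> (C \<subseteq> {..<N} \<times> UNIV \<and> violates A C)"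
  have kn: "k \<le> n" using assms by simp
  have ne: "k_clauses n k \<noteq> {}" by (rule k_clauses_nonempty[OF kn])
  have finU: "finite (set_pmf ?U)" using ne by (simp add: finite_k_clauses)
  have q: "q > 0" using assms kn by (simp add: q_def)
  have r: "measure_pmf.prob (replicate_pmf t ?U) {cs. ?R A (choose_inside N cs)} =
        1 - (1 - (1 - q) ^ t) / 2 ^ k" for A
  proof -
    let ?E = "{cs. \<exists>C. find (\<lambda>C. C \<subseteq> {..<N} \<times> UNIV) cs = Some C \<and> violates A C}"
    have "q * measure_pmf.prob (replicate_pmf t ?U) ?E = q / 2 ^ k * (1 - (1 - q) ^ t)"
      using prob_find_replicate_pmf[OF finU, of "\<lambda>C. C \<subseteq> {..<N} \<times> UNIV" t "violates A"]
      by (simp add: prob_clause_subset prob_clause_inside_violated assms kn q_def)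
    \<comment> \<open>Here \<open>k \<le> N\<close> enters: it makes \<open>q\<close> positive, so
      that \<open>q\<close> cancels.\<close>
    hence E: "measure_pmf.prob (replicate_pmf t ?U) ?E = (1 - (1 - q) ^ t) / 2 ^ k"
      using q by (metis (no_types, lifting) mult_left_cancel less_irrefl times_divide_eq_left times_divide_eq_right)
    have "measure_pmf.prob (replicate_pmf t ?U) {cs. ?R A (choose_inside N cs)} =
          measure_pmf.prob (replicate_pmf t ?U) (UNIV - ?E)"
    proof (rule measure_eq_AE)
      show "AE cs in measure_pmf (replicate_pmf t ?U).
              (cs \<in> {cs. ?R A (choose_inside N cs)}) = (cs \<in> UNIV - ?E)"
        unfolding AE_measure_pmf_iff
      proof
        fix cs assume "cs \<in> set_pmf (replicate_pmf t ?U)"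
        hence "cs \<noteq> []" using assms(3) by (auto dest: length_replicate_pmf)
        from find_choose_inside[OF this, of N "violates A"]
        show "(cs \<in> {cs. ?R A (choose_inside N cs)}) = (cs \<in> UNIV - ?E)" by auto
      qed
    qed auto
    also have "\<dots> = 1 - measure_pmf.prob (replicate_pmf t ?U) ?E"
      using measure_pmf.prob_compl[of ?E "replicate_pmf t ?U"] by simp
    finally show ?thesis by (simp add: E)
  qed
  have "measure_pmf.prob (achlioptas_formula t k n (\<lambda>_. choose_inside N) m) {F. satisfiable F} =
        measure_pmf.prob ?H (map snd -` {F. satisfiable F})"
    by (simp add: achlioptas_formula_def)
  also have "\<dots> \<le> measure_pmf.prob ?H (\<Union>A\<in>Pow {..<N}. {h. \<forall>x\<in>set h. ?R A (snd x)})"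
  proof (rule measure_pmf.finite_measure_mono)
    show "map snd -` {F. satisfiable F} \<subseteq> (\<Union>A\<in>Pow {..<N}. {h :: history. \<forall>x\<in>set h. ?R A (snd x)})"
    proof
      fix h :: history assume "h \<in> map snd -` {F. satisfiable F}"
      hence "satisfiable (map snd h)" by simp
      from satisfiable_imp_violates[OF this, of N]
      show "h \<in> (\<Union>A\<in>Pow {..<N}. {h. \<forall>x\<in>set h. ?R A (snd x)})" by auto
    qed
  qed simp
  also have "\<dots> \<le> (\<Sum>A\<in>Pow {..<N}. measure_pmf.prob ?H {h. \<forall>x\<in>set h. ?R A (snd x)})"
    by (rule measure_pmf.finite_measure_subadditive_finite) auto
  also have "\<dots> = (\<Sum>A\<in>Pow {..<N}. (1 - (1 - (1 - q) ^ t) / 2 ^ k) ^ m)"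
  proof (rule sum.cong[OF refl])
    fix A
    show "measure_pmf.prob ?H {h. \<forall>x\<in>set h. ?R A (snd x)} = (1 - (1 - (1 - q) ^ t) / 2 ^ k) ^ m"
      by (simp only: prob_history_all[OF ne, where R = "?R A"] r)
  qed
  also have "\<dots> = 2 ^ N * (1 - (1 - (1 - q) ^ t) / 2 ^ k) ^ m"
    by (simp add: card_Pow)
  finally show ?thesis .
qed

lemma achlioptas_unsat_whp:
  fixes N :: "nat \<Rightarrow> nat" and \<alpha> \<epsilon> c qmin :: real
  assumes "t > 0" and \<alpha>: "\<alpha> > 0" and qmin: "qmin \<le> 1"
    and N: "\<And>n. N n \<le> n" "\<And>n. real (N n) \<le> \<epsilon> * real n + 1"
    and kN: "\<forall>\<^sub>F n in sequentially. k \<le> N n"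
    and q: "\<forall>\<^sub>F n in sequentially. qmin \<le> real (N n choose k) / real (n choose k)"
    and less: "\<epsilon> * ln 2 < \<alpha> * (1 - (1 - qmin) ^ t) / 2 ^ k"
  shows "(\<lambda>n. measure_pmf.prob (achlioptas_formula t k n (\<lambda>_. choose_inside (N n)) (nat \<lfloor>\<alpha> * real n\<rfloor>))
               {F. \<not> satisfiable F}) \<longlonglongrightarrow> 1"
proof -
  define p where "p = (1 - (1 - qmin) ^ t) / 2 ^ k"
  define P where "P = (\<lambda>n. measure_pmf.prob (achlioptas_formula t k n (\<lambda>_. choose_inside (N n)) (nat \<lfloor>\<alpha> * real n\<rfloor>))
               {F. satisfiable F})"
  define d where "d = \<alpha> * p - \<epsilon> * ln 2"
  have d: "d > 0" using less by (simp add: d_def p_def)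
  \<comment> \<open>The additive constants absorb rounding: \<open>ln 2\<close> that of
    \<open>N n\<close>, and \<open>\<bar>p\<bar>\<close> that of the number of steps.\<close>
  have bound: "\<forall>\<^sub>F n in sequentially. P n \<le> exp (ln 2 + \<bar>p\<bar> - d * real n)"
    using kN q
  proof eventually_elim
    case (elim n)
    define m where "m = nat \<lfloor>\<alpha> * real n\<rfloor>"
    define q where "q = real (N n choose k) / real (n choose k)"
    define r where "r = (1 - (1 - q) ^ t) / 2 ^ k"
    have "N n choose k \<le> n choose k" by (rule binomial_right_mono[OF N(1)])
    hence q1: "0 \<le> q" "q \<le> 1" using N(1)[of n] elim by (auto simp: q_def divide_le_eq_1)
    have "(1 - q) ^ t \<le> (1 - qmin) ^ t" using elim q1 by (intro power_mono) (auto simp: q_def)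
    hence pr: "p \<le> r" by (simp add: p_def r_def divide_right_mono)
    have r1: "r \<le> 1"
    proof -
      have "1 - (1 - q) ^ t \<le> 1" using q1 by simp
      also have "1 \<le> (2::real) ^ k" by simp
      finally show ?thesis by (simp add: r_def divide_le_eq)
    qed
    have r0: "r \<ge> 0" using q1 by (simp add: r_def power_le_one)
    have m: "real m \<ge> \<alpha> * real n - 1" "real m \<ge> 0" unfolding m_def by linarith+
    have "P n \<le> 2 ^ N n * (1 - r) ^ m"
      unfolding P_def m_def r_def q_def
      by (rule prob_achlioptas_satisfiable_le) (use elim N assms in auto)
    also have "\<dots> \<le> exp (ln 2 * (\<epsilon> * real n + 1)) * exp (- r * real m)"
    proof (rule mult_mono)
      have "(2::real) ^ N n = exp (ln 2 * real (N n))"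
        by (metis exp_ln exp_of_nat2_mult zero_less_numeral)
      also have "\<dots> \<le> exp (ln 2 * (\<epsilon> * real n + 1))"
        using N(2)[of n] by simp
      finally show "(2::real) ^ N n \<le> \<dots>" .
      have "(1 - r) ^ m \<le> exp (- r) ^ m" using r1 exp_ge_add_one_self[of "-r"] by (intro power_mono) auto
      thus "(1 - r) ^ m \<le> exp (- r * real m)" by (simp only: exp_of_nat2_mult)
    qed (use r1 in auto)
    also have "\<dots> = exp (ln 2 * (\<epsilon> * real n + 1) - r * real m)"
      by (simp add: exp_diff exp_minus divide_inverse)
    also have "\<dots> \<le> exp (ln 2 + \<bar>p\<bar> - d * real n)"
    proof -
      have "p * real m \<le> r * real m" using pr m by (intro mult_right_mono) auto
      moreover have "p * real m \<ge> p * (\<alpha> * real n) - \<bar>p\<bar>"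
      proof (cases "p \<ge> 0")
        case True
        have "p * real m \<ge> p * (\<alpha> * real n - 1)" using m True by (intro mult_left_mono) auto
        thus ?thesis using True by (simp add: algebra_simps)
      next
        case False
        have "real m \<le> \<alpha> * real n" unfolding m_def using \<alpha> by (intro of_nat_floor) auto
        hence "p * real m \<ge> p * (\<alpha> * real n)" using False by (intro mult_left_mono_neg) auto
        thus ?thesis by simp
      qed
      ultimately show ?thesis by (simp add: d_def algebra_simps)
    qed
    finally show ?case .
  qed
  have "(\<lambda>n. exp (ln 2 + \<bar>p\<bar> - d * real n)) \<longlonglongrightarrow> 0" using d by real_asymp
  hence "P \<longlonglongrightarrow> 0"
    by (intro tendsto_sandwich[OF _ bound tendsto_const] always_eventually) (simp_all add: P_def)
  hence "(\<lambda>n. 1 - P n) \<longlonglongrightarrow> 1 - 0" by (intro tendsto_intros)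
  also have "(\<lambda>n. 1 - P n) = (\<lambda>n. measure_pmf.prob (achlioptas_formula t k n (\<lambda>_. choose_inside (N n)) (nat \<lfloor>\<alpha> * real n\<rfloor>))
               {F. \<not> satisfiable F})"
  proof
    fix n
    show "1 - P n = measure_pmf.prob (achlioptas_formula t k n (\<lambda>_. choose_inside (N n)) (nat \<lfloor>\<alpha> * real n\<rfloor>)) {F. \<not> satisfiable F}"
      using measure_pmf.prob_compl[of "{F. satisfiable F}" "achlioptas_formula t k n (\<lambda>_. choose_inside (N n)) (nat \<lfloor>\<alpha> * real n\<rfloor>)"]
      by (simp add: P_def Compl_eq[symmetric] Collect_neg_eq Compl_eq_Diff_UNIV)
  qed
  finally show ?thesis by simp
qed

section \<open>Satisfiability at low density\<close>

text \<open>The induction of Halmos and Vaughan, splitting at a proper subfamily for which the condition is tight.\<close>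

lemma hall:
  fixes V :: "'i \<Rightarrow> 'a set"
  assumes "finite I" "\<And>i. i \<in> I \<Longrightarrow> finite (V i)" "\<And>J. J \<subseteq> I \<Longrightarrow> card J \<le> card (\<Union>i\<in>J. V i)"
  shows "\<exists>f. inj_on f I \<and> (\<forall>i\<in>I. f i \<in> V i)"
  using assms
proof (induction I arbitrary: V rule: finite_psubset_induct)
  case (psubset I)
  have finU: "finite (\<Union>i\<in>J. V i)" if "J \<subseteq> I" for J
    using that psubset.prems psubset.hyps finite_subset by blast
  consider "I = {}" | J where "J \<noteq> {}" "J \<subset> I" "card (\<Union>i\<in>J. V i) = card J"
    | i0 where "i0 \<in> I" "\<And>J. J \<noteq> {} \<Longrightarrow> J \<subset> I \<Longrightarrow> card (\<Union>i\<in>J. V i) \<noteq> card J"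
    by blast
  thus ?case
  proof cases
    case 2
    define W where "W = (\<Union>i\<in>J. V i)"
    have finJ: "finite J" using 2 psubset.hyps finite_subset by blast
    have finW: "finite W" unfolding W_def using finU 2 by blast
    have "\<exists>f. inj_on f J \<and> (\<forall>i\<in>J. f i \<in> V i)"
      by (rule psubset.IH) (use 2 psubset.prems in \<open>auto simp: subset_iff\<close>)
    then obtain f where f: "inj_on f J" "\<And>i. i \<in> J \<Longrightarrow> f i \<in> V i" by blast
    have "\<exists>g. inj_on g (I - J) \<and> (\<forall>i\<in>I-J. g i \<in> V i - W)"
    proof (rule psubset.IH)
      show "I - J \<subset> I" using 2 by blast
      show "finite (V i - W)" if "i \<in> I - J" for i using that psubset.prems by auto
      show "card K \<le> card (\<Union>i\<in>K. V i - W)" if K: "K \<subseteq> I - J" for K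
      proof -
        have finK: "finite K" using K psubset.hyps finite_subset by blast
        \<comment> \<open>Since \<open>J\<close> is tight, the condition for
          \<open>J \<union> K\<close> leaves at least \<open>card K\<close> elements outside
          \<open>W\<close>.\<close>
        have "card J + card K = card (J \<union> K)"
          using K finJ finK by (subst card_Un_disjoint) auto
        also have "\<dots> \<le> card (\<Union>i\<in>J \<union> K. V i)" by (rule psubset.prems) (use 2 K in auto)
        also have "(\<Union>i\<in>J \<union> K. V i) = W \<union> (\<Union>i\<in>K. V i - W)" by (auto simp: W_def)
        also have "card \<dots> = card W + card (\<Union>i\<in>K. V i - W)"
          using finW finU[of K] K by (subst card_Un_disjoint) (auto intro: finite_subset[of _ "\<Union>i\<in>K. V i"])
        finally show ?thesis using 2 by (simp add: W_def)
      qed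
    qed
    then obtain g where g: "inj_on g (I - J)" "\<And>i. i \<in> I - J \<Longrightarrow> g i \<in> V i - W" by blast
    let ?h = "\<lambda>i. if i \<in> J then f i else g i"
    have W: "f i \<in> W" if "i \<in> J" for i using f(2) that by (auto simp: W_def)
    have "inj_on ?h I"
      using f(1) g W unfolding inj_on_def by (metis Diff_iff)
    moreover have "\<forall>i\<in>I. ?h i \<in> V i" using f(2) g(2) by auto
    ultimately show ?thesis by (intro exI[of _ ?h] conjI)
  next
    case 3
    have "card {i0} \<le> card (\<Union>i\<in>{i0}. V i)" by (rule psubset.prems) (use 3 in auto)
    hence "V i0 \<noteq> {}" by auto
    then obtain x where x: "x \<in> V i0" by blast
    have "\<exists>f. inj_on f (I - {i0}) \<and> (\<forall>i\<in>I-{i0}. f i \<in> V i - {x})"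
    proof (rule psubset.IH)
      show "I - {i0} \<subset> I" using 3 by blast
      show "finite (V i - {x})" if "i \<in> I - {i0}" for i using that psubset.prems by auto
      show "card K \<le> card (\<Union>i\<in>K. V i - {x})" if K: "K \<subseteq> I - {i0}" for K
      proof (cases "K = {}")
        case False
        \<comment> \<open>No proper subfamily is tight, so each has an element to spare and
          \<open>x\<close> can be reserved for \<open>i0\<close>.\<close>
        have "card K \<noteq> card (\<Union>i\<in>K. V i)" using 3(2)[OF False] 3(1) K by force
        moreover have "card K \<le> card (\<Union>i\<in>K. V i)" by (rule psubset.prems) (use K in auto)
        ultimately have "card K \<le> card (\<Union>i\<in>K. V i) - 1" by simp
        also have "\<dots> \<le> card ((\<Union>i\<in>K. V i) - {x})" using diff_card_le_card_Diff[of "{x}" "\<Union>i\<in>K. V i"] by simp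
        also have "(\<Union>i\<in>K. V i) - {x} = (\<Union>i\<in>K. V i - {x})" by auto
        finally show ?thesis .
      qed simp
    qed
    then obtain f where f: "inj_on f (I - {i0})" "\<And>i. i \<in> I - {i0} \<Longrightarrow> f i \<in> V i - {x}" by blast
    have "inj_on (f(i0 := x)) I"
    proof -
      have "inj_on (f(i0 := x)) (insert i0 (I - {i0}))"
        using f by (subst inj_on_insert) (auto intro: inj_on_fun_updI)
      thus ?thesis using 3 by (simp add: insert_absorb)
    qed
    moreover have "\<forall>i\<in>I. (f(i0 := x)) i \<in> V i" using f(2) x by auto
    ultimately show ?thesis by blast
  qed simp
qed

lemma unsatisfiable_imp_deficient:
  assumes "\<not> satisfiable F" "\<And>C. C \<in> set F \<Longrightarrow> finite C"
  shows "\<exists>J\<subseteq>{..<length F}. card (\<Union>i\<in>J. fst ` (F ! i)) < card J"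
proof (rule ccontr)
  assume "\<not> ?thesis"
  hence "\<exists>f. inj_on f {..<length F} \<and> (\<forall>i\<in>{..<length F}. f i \<in> fst ` (F ! i))"
    by (intro hall) (auto simp: not_less assms(2))
  then obtain f where f: "inj_on f {..<length F}" "\<And>i. i < length F \<Longrightarrow> f i \<in> fst ` (F ! i)" by auto
  hence "\<forall>i. \<exists>b. i < length F \<longrightarrow> (f i, b) \<in> F ! i" by force
  then obtain b where b: "\<And>i. i < length F \<Longrightarrow> (f i, b i) \<in> F ! i" by metis
  have "satisfiable F"
    unfolding satisfiable_def
  proof (rule exI[of _ "\<lambda>v. b (inv_into {..<length F} f v)"], rule ballI)
    fix C assume "C \<in> set F"
    then obtain i where i: "i < length F" "C = F ! i" by (auto simp: in_set_conv_nth)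
    show "\<exists>(v, c)\<in>C. b (inv_into {..<length F} f v) = c"
      using b[OF i(1)] i f(1) by (auto intro!: bexI[of _ "(f i, b i)"] simp: inv_into_f_f)
  qed
  thus False using assms(1) by simp
qed

section \<open>Binomial ratios and the first moment over Hall violators\<close>

lemma binomial_ratio_prod:
  assumes "k \<le> a" "a \<le> n"
  shows "real (a choose k) / real (n choose k) = (\<Prod>i<k. (real a - real i) / (real n - real i))"
proof -
  have "real (a choose k) / real (n choose k) =
     (\<Prod>i = 0..<k. real (a - i) / real (k - i)) / (\<Prod>i = 0..<k. real (n - i) / real (k - i))"
    using assms by (simp add: binomial_altdef_of_nat)
  also have "\<dots> = (\<Prod>i = 0..<k. (real a - real i) / (real n - real i))"
    unfolding prod_dividef[symmetric] using assms by (intro prod.cong) (auto simp: of_nat_diff)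
  finally show ?thesis by (simp add: atLeast0LessThan)
qed

lemma binomial_ratio_le:
  assumes "a \<le> n" "k \<le> n"
  shows "real (a choose k) / real (n choose k) \<le> (real a / real n) ^ k"
proof (cases "k \<le> a")
  case True
  have "(\<Prod>i<k. (real a - real i) / (real n - real i)) \<le> (\<Prod>i<k. real a / real n)"
  proof (rule prod_mono, safe)
    fix i assume "i < k"
    thus "0 \<le> (real a - real i) / (real n - real i)" using True assms by auto
    have "real i * real a \<le> real i * real n" using assms by (intro mult_left_mono) auto
    moreover have "real n - real i > 0" "real n > 0" using \<open>i < k\<close> True assms by auto
    ultimately show "(real a - real i) / (real n - real i) \<le> real a / real n"
      by (simp add: field_simps)
  qed
  thus ?thesis using binomial_ratio_prod[OF True assms(1)] by simp
qed (simp add: binomial_eq_0)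

lemma binomial_ratio_ge:
  assumes "k \<le> a" "a \<le> n"
  shows "((real a - real k) / real n) ^ k \<le> real (a choose k) / real (n choose k)"
proof -
  have "(\<Prod>i<k. (real a - real k) / real n) \<le> (\<Prod>i<k. (real a - real i) / (real n - real i))"
    using assms by (intro prod_mono conjI frac_le) auto
  thus ?thesis using binomial_ratio_prod[OF assms] by simp
qed

text \<open>One term of the series of \<open>exp (real j)\<close> is at most the whole sum.\<close>

lemma power_self_le_fact_exp: "real j ^ j \<le> fact j * exp (real j)"
proof -
  have "(\<Sum>n\<in>{j}. real j ^ n /\<^sub>R fact n) \<le> exp (real j)"
    unfolding exp_def by (rule sum_le_suminf) (use summable_exp_generic[of "real j"] in \<open>auto simp: field_simps\<close>)
  thus ?thesis by (simp add: field_simps)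
qed

lemma sum_id_over_pow2: "(\<Sum>j\<in>{1..m}. real j / 2 ^ j) = 2 - (real m + 2) / 2 ^ m"
  by (induction m) (auto simp: field_simps)

text \<open>The product is at most \<open>(m/n)^j (j^j/j!)^2 (j/n)\<close>, and
  \<open>j^j/j!\<close> is at most \<open>3^j\<close>. The constant 18 turns \<open>9 m/n\<close>
  into at most one half. The factor \<open>1/n\<close>, due to the violator having one variable too
  few, makes the whole sum vanish in the limit.\<close>

lemma hall_first_moment_term:
  assumes "j \<ge> 1" "n > 0" "18 * m \<le> n"
  shows "real (m choose j) * real (n choose (j - 1)) * (real (j - 1) / real n) ^ (2 * j) \<le>
         real j / 2 ^ j / real n"
proof -
  have e: "exp (real j) \<le> 3 ^ j"
    using power_mono[OF exp_le, of j] by (simp add: exp_of_nat_mult[symmetric])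
  have jf: "real j ^ j / fact j \<le> 3 ^ j"
    using order_trans[OF power_self_le_fact_exp[of j] mult_left_mono[OF e, of "fact j :: real"]]
    by (simp add: divide_le_eq mult.commute)
  have a: "real (m choose j) \<le> real m ^ j / fact j"
  proof -
    have "real ((m choose j) * fact j) \<le> real (m ^ j)"
      using binomial_fact_pow[of m j] by (rule of_nat_mono)
    thus ?thesis by (simp add: pos_le_divide_eq)
  qed
  have b: "real (n choose (j - 1)) \<le> real n ^ (j - 1) * real j / fact j"
  proof -
    have "real (n choose (j - 1)) \<le> real n ^ (j - 1) / fact (j - 1)"
    proof -
      have "real ((n choose (j - 1)) * fact (j - 1)) \<le> real (n ^ (j - 1))"
        using binomial_fact_pow[of n "j - 1"] by (rule of_nat_mono)
      thus ?thesis by (simp add: pos_le_divide_eq)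
    qed
    thus ?thesis using assms(1) by (simp add: fact_reduce[of j])
  qed
  have c: "(real (j - 1) / real n) ^ (2 * j) \<le> (real j / real n) ^ (2 * j)"
    by (intro power_mono divide_right_mono) auto
  have "real (m choose j) * real (n choose (j - 1)) * (real (j - 1) / real n) ^ (2 * j) \<le>
        (real m ^ j / fact j) * (real n ^ (j - 1) * real j / fact j) * (real j / real n) ^ (2 * j)"
    by (intro mult_mono a b c) auto
  also have "\<dots> = (real m / real n) ^ j * (real j ^ j / fact j) ^ 2 * (real j / real n)"
  proof -
    have "real n ^ (j - 1) = real n ^ j / real n"
      using assms(1,2) by (cases j) auto
    moreover have "(real j / real n) ^ (2 * j) = (real j ^ j) ^ 2 / (real n ^ j) ^ 2"
      by (simp add: power_divide power_mult[symmetric] mult.commute)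
    ultimately show ?thesis using assms(2)
      by (simp only: power_divide) (simp add: power2_eq_square field_simps)
  qed
  also have "\<dots> \<le> (1 / 18) ^ j * (3 ^ j) ^ 2 * (real j / real n)"
    using assms by (intro mult_mono power_mono jf) (auto simp: field_simps)
  also have "\<dots> = (1 / 18 * 9) ^ j * (real j / real n)"
  proof -
    have "((3::real) ^ j) ^ 2 = 9 ^ j" by (simp add: power2_eq_square flip: power_mult_distrib)
    thus ?thesis by (simp only: power_mult_distrib)
  qed
  also have "\<dots> = real j / 2 ^ j / real n" by (simp add: power_divide)
  finally show ?thesis .
qed

lemma prob_replicate_pmf_subset:
  assumes "finite (set_pmf p)" "J \<subseteq> {..<m}"
  shows "measure_pmf.prob (replicate_pmf m p) {xs. \<forall>i\<in>J. P (xs ! i)} =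
         measure_pmf.prob p {x. P x} ^ card J"
proof -
  have "of_bool (\<forall>i\<in>J. P (xs ! i)) = (\<Prod>i<m. if i \<in> J then of_bool (P (xs ! i)) else (1::real))" for xs
  proof -
    have "(\<Prod>i<m. if i \<in> J then of_bool (P (xs ! i)) else (1::real)) = (\<Prod>i\<in>J. of_bool (P (xs ! i)))"
      using assms(2) by (subst prod.If_cases) (auto simp: Int_absorb1)
    thus ?thesis using finite_subset[OF assms(2)] by (simp add: prod_zero_iff of_bool_def) 
  qed
  hence "measure_pmf.prob (replicate_pmf m p) {xs. \<forall>i\<in>J. P (xs ! i)} =
     measure_pmf.expectation (replicate_pmf m p) (\<lambda>xs. \<Prod>i<m. if i \<in> J then of_bool (P (xs ! i)) else 1)"
    by (simp only: prob_eq_expectation mem_Collect_eq)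
  also have "\<dots> = (\<Prod>i<m. measure_pmf.expectation p (\<lambda>x. if i \<in> J then of_bool (P x) else 1))"
    by (rule expectation_replicate_pmf_prod[OF assms(1)])
  also have "\<dots> = (\<Prod>i<m. if i \<in> J then measure_pmf.prob p {x. P x} else 1)"
  proof (rule prod.cong[OF refl])
    fix i
    show "measure_pmf.expectation p (\<lambda>x. if i \<in> J then of_bool (P x) else 1) =
          (if i \<in> J then measure_pmf.prob p {x. P x} else 1)"
      by (cases "i \<in> J") (simp_all only: prob_eq_expectation mem_Collect_eq if_True if_False
          measure_pmf.prob_space lebesgue_integral_const scaleR_one, simp)
  qed
  also have "\<dots> = measure_pmf.prob p {x. P x} ^ card J"
    using assms(2) by (subst prod.If_cases) (auto simp: Int_absorb1)
  finally show ?thesis .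
qed

text \<open>Union bound over the index sets \<open>J\<close> of deficient clause families and the
  sets \<open>W\<close> of \<open>card J - 1\<close> variables containing all their
  variables.\<close>

lemma prob_random_unsat_le:
  assumes "k \<ge> 2" "k \<le> n" "18 * m \<le> n"
  shows "measure_pmf.prob (random_formula k n m) {F. \<not> satisfiable F} \<le> 2 / real n"
proof -
  let ?U = "pmf_of_set (k_clauses n k)"
  let ?W = "\<lambda>J. {W. W \<subseteq> {..<n} \<and> card W = card J - 1}"
  let ?E = "\<lambda>J W. {F. \<forall>i\<in>J. F ! i \<subseteq> W \<times> (UNIV :: bool set)}"
  let ?Js = "Pow {..<m} - {{}}"
  have ne: "k_clauses n k \<noteq> {}" by (rule k_clauses_nonempty[OF assms(2)])
  have finU: "finite (set_pmf ?U)" using ne by (simp add: finite_k_clauses)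
  have finJs: "finite ?Js" by simp
  have finW: "finite (?W J)" for J by (rule finite_subset[of _ "Pow {..<n}"]) auto
  have "measure_pmf.prob (random_formula k n m) {F. \<not> satisfiable F} \<le>
        measure_pmf.prob (random_formula k n m) (\<Union>J\<in>?Js. \<Union>W\<in>?W J. ?E J W)"
  proof (rule measure_pmf.finite_measure_mono_AE)
    show "AE F in measure_pmf (random_formula k n m).
       F \<in> {F. \<not> satisfiable F} \<longrightarrow> F \<in> (\<Union>J\<in>?Js. \<Union>W\<in>?W J. ?E J W)"
      unfolding AE_measure_pmf_iff random_formula_def
    proof safe
      fix F assume F: "F \<in> set_pmf (replicate_pmf m ?U)" "\<not> satisfiable F"
      have len: "length F = m" using F by (auto dest: length_replicate_pmf)
      have setF: "C \<in> k_clauses n k" if "C \<in> set F" for C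
        using F(1) that ne by (auto simp: set_replicate_pmf finite_k_clauses)
      have "finite C" if "C \<in> set F" for C
        using setF[OF that] by (auto simp: k_clauses_def intro: finite_subset[of _ "{..<n} \<times> UNIV"])
      from unsatisfiable_imp_deficient[OF F(2) this] obtain J where
        J: "J \<subseteq> {..<m}" "card (\<Union>i\<in>J. fst ` (F ! i)) < card J" using len by auto
      have sub: "(\<Union>i\<in>J. fst ` (F ! i)) \<subseteq> {..<n}"
      proof (intro UN_least image_subsetI)
        fix i c assume i: "i \<in> J" and c: "c \<in> F ! i"
        have "F ! i \<in> set F" using i J len by (intro nth_mem) auto
        hence "F ! i \<subseteq> {..<n} \<times> UNIV" using setF by (auto simp: k_clauses_def)
        thus "fst c \<in> {..<n}" using c by auto
      qed
      have "card J \<le> m" using card_mono[OF _ J(1)] by simp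
      hence cJ: "card J - 1 \<le> n" using assms(3) by simp
      have "card (\<Union>i\<in>J. fst ` (F ! i)) \<le> card J - 1" using J(2) by linarith
      \<comment> \<open>The variable set is enlarged to exactly \<open>card J - 1\<close> elements,
        which fit into \<open>{..<n}\<close> because \<open>m \<le> n\<close>. This fixes the size
        of \<open>W\<close> in the union bound.\<close>
      then obtain W where W: "(\<Union>i\<in>J. fst ` (F ! i)) \<subseteq> W" "W \<subseteq> {..<n}" "card W = card J - 1"
        using exists_subset_between[of "\<Union>i\<in>J. fst ` (F ! i)" "card J - 1" "{..<n}"] sub cJ by auto
      have "J \<noteq> {}" using J(2) by auto
      moreover have "F ! i \<subseteq> W \<times> UNIV" if "i \<in> J" for i using W(1) that by force
      ultimately show "F \<in> (\<Union>J\<in>?Js. \<Union>W\<in>?W J. ?E J W)" using J W by blast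
    qed
  qed auto
  also have "\<dots> \<le> (\<Sum>J\<in>?Js. measure_pmf.prob (random_formula k n m) (\<Union>W\<in>?W J. ?E J W))"
    by (rule measure_pmf.finite_measure_subadditive_finite) auto
  also have "\<dots> \<le> (\<Sum>J\<in>?Js. \<Sum>W\<in>?W J. measure_pmf.prob (random_formula k n m) (?E J W))"
    by (intro sum_mono measure_pmf.finite_measure_subadditive_finite finW) auto
  also have "\<dots> \<le> (\<Sum>J\<in>?Js. \<Sum>W\<in>?W J. (real (card J - 1) / real n) ^ (2 * card J))"
  proof (intro sum_mono)
    fix J W assume J: "J \<in> ?Js" and W: "W \<in> ?W J"
    have Wn: "card W \<le> n" using W card_mono[of "{..<n}" W] by auto
    have "measure_pmf.prob (random_formula k n m) (?E J W) = (real (card W choose k) / real (n choose k)) ^ card J"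
      unfolding random_formula_def
      using J W assms by (subst prob_replicate_pmf_subset[OF finU]) (auto simp: prob_clause_subset)
    also have "\<dots> \<le> ((real (card W) / real n) ^ k) ^ card J"
      using Wn assms by (intro power_mono binomial_ratio_le) auto
    \<comment> \<open>The ratio is at most one and \<open>k \<ge> 2\<close>, so clauses of length
      two are the worst case.\<close>
    also have "\<dots> \<le> ((real (card W) / real n) ^ 2) ^ card J"
      using Wn assms by (intro power_mono power_decreasing) (auto simp: divide_le_eq)
    finally show "measure_pmf.prob (random_formula k n m) (?E J W) \<le>
        (real (card J - 1) / real n) ^ (2 * card J)" using W by (simp add: power_mult)
  qed
  also have "\<dots> = (\<Sum>J\<in>?Js. real (n choose (card J - 1)) * (real (card J - 1) / real n) ^ (2 * card J))"
    by (simp add: n_subsets)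
  also have "\<dots> = (\<Sum>j\<in>{1..m}. \<Sum>J\<in>{J \<in> ?Js. card J = j}.
                    real (n choose (card J - 1)) * (real (card J - 1) / real n) ^ (2 * card J))"
  proof (rule sum.group[symmetric])
    show "card ` ?Js \<subseteq> {1..m}"
    proof (rule image_subsetI)
      fix J assume "J \<in> ?Js"
      hence "J \<subseteq> {..<m}" "J \<noteq> {}" by auto
      thus "card J \<in> {1..m}" using card_mono[of "{..<m}" J] finite_subset[of J "{..<m}"]
        by (auto simp: Suc_le_eq card_gt_0_iff)
    qed
  qed auto
  also have "\<dots> = (\<Sum>j\<in>{1..m}. real (m choose j) * real (n choose (j - 1)) * (real (j - 1) / real n) ^ (2 * j))"
  proof (rule sum.cong[OF refl])
    fix j assume j: "j \<in> {1..m}"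
    have "{J \<in> ?Js. card J = j} = {J. J \<subseteq> {..<m} \<and> card J = j}" using j by auto
    thus "(\<Sum>J\<in>{J \<in> ?Js. card J = j}.
             real (n choose (card J - 1)) * (real (card J - 1) / real n) ^ (2 * card J)) =
          real (m choose j) * real (n choose (j - 1)) * (real (j - 1) / real n) ^ (2 * j)"
      by (simp add: n_subsets)
  qed
  also have "\<dots> \<le> (\<Sum>j\<in>{1..m}. real j / 2 ^ j / real n)"
    using assms by (intro sum_mono hall_first_moment_term) auto
  also have "\<dots> = (2 - (real m + 2) / 2 ^ m) / real n"
    by (simp only: sum_divide_distrib[symmetric] sum_id_over_pow2)
  also have "\<dots> \<le> 2 / real n" by (intro divide_right_mono) auto
  finally show ?thesis .
qed

lemma random_sat_whp_low_density:
  assumes "k \<ge> 2"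
  shows "(\<lambda>n. measure_pmf.prob (random_formula k n (nat \<lfloor>1 / 18 * real n\<rfloor>)) {F. satisfiable F}) \<longlonglongrightarrow> 1"
proof (rule tendsto_sandwich[where h = "\<lambda>_. 1"])
  show "\<forall>\<^sub>F n in sequentially. 1 - 2 / real n \<le>
    measure_pmf.prob (random_formula k n (nat \<lfloor>1 / 18 * real n\<rfloor>)) {F. satisfiable F}"
    using eventually_ge_at_top[of k]
  proof eventually_elim
    case (elim n)
    let ?p = "random_formula k n (nat \<lfloor>1 / 18 * real n\<rfloor>)"
    have "18 * nat \<lfloor>1 / 18 * real n\<rfloor> \<le> n" by linarith
    from prob_random_unsat_le[OF assms elim this]
    have "measure_pmf.prob ?p {F. \<not> satisfiable F} \<le> 2 / real n" .
    moreover have "measure_pmf.prob ?p {F. \<not> satisfiable F} = 1 - measure_pmf.prob ?p {F. satisfiable F}"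
      using measure_pmf.prob_compl[of "{F. satisfiable F}" ?p]
      by (simp add: Collect_neg_eq Compl_eq_Diff_UNIV)
    ultimately show ?case by simp
  qed
  show "(\<lambda>n. 1 - 2 / real n) \<longlonglongrightarrow> 1" by real_asymp
qed (auto intro: always_eventually)

text \<open>An inside clause is offered with a probability bounded below uniformly in
  \<open>n\<close>, so a constant number of choices makes it available in more than half of the
  steps, while the union bound ranges over only \<open>\<epsilon> n\<close> variables.\<close>

lemma threshold_lowerable_many_choices:
  assumes "k \<ge> 2"
  shows "\<exists>t. threshold_lowerable k t"
proof -
  \<comment> \<open>Chosen to equal \<open>\<alpha> (1/2) / 2^k\<close> for \<alpha> = 1/18; the
    inequality required by \<open>achlioptas_unsat_whp\<close> is then strict because
    \<open>ln 2 < 1\<close>.\<close>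
  define \<epsilon> :: real where "\<epsilon> = 1 / 18 / 2 ^ (k + 1)"
  \<comment> \<open>Halving \<open>\<epsilon>\<close> leaves room for the \<open>real k\<close>
    subtracted in \<open>binomial_ratio_ge\<close>.\<close>
  define q0 where "q0 = (\<epsilon> / 2) ^ k"
  define N where "N = (\<lambda>n. nat \<lceil>\<epsilon> * real n\<rceil>)"
  have \<epsilon>: "\<epsilon> > 0" "\<epsilon> < 1"
  proof -
    have "(2::real) ^ (k + 1) \<ge> 1" by (rule one_le_power) simp
    hence "1 / 2 ^ (k + 1) \<le> (1::real)" by simp
    thus "\<epsilon> > 0" "\<epsilon> < 1" by (auto simp: \<epsilon>_def)
  qed
  have q0: "0 < q0" "q0 \<le> 1" using \<epsilon> by (auto simp: q0_def intro!: power_le_one)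
  obtain t where t: "(1 - q0) ^ t < 1 / 2"
    using real_arch_pow_inv[of "1/2" "1 - q0"] q0 by auto
  have t0: "t > 0" using t by (cases t) auto
  have "(\<lambda>n. measure_pmf.prob (achlioptas_formula t k n (\<lambda>_. choose_inside (N n)) (nat \<lfloor>1 / 18 * real n\<rfloor>))
               {F. \<not> satisfiable F}) \<longlonglongrightarrow> 1"
  proof (rule achlioptas_unsat_whp[where qmin = q0 and \<epsilon> = \<epsilon>])
    show "N n \<le> n" for n
      using \<epsilon> mult_right_mono[of \<epsilon> 1 "real n"] by (simp add: N_def ceiling_le_iff nat_le_iff)
    show N1: "real (N n) \<le> \<epsilon> * real n + 1" for n
      unfolding N_def using \<epsilon> by (simp add: of_nat_nat)
    have N2: "real (N n) \<ge> \<epsilon> * real n" for n unfolding N_def by linarith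
    have "\<forall>\<^sub>F n in sequentially. real k \<le> \<epsilon> / 2 * real n" using \<epsilon> by real_asymp
    hence ev: "\<forall>\<^sub>F n in sequentially. real k \<le> \<epsilon> / 2 * real n \<and> n > 0"
      using eventually_gt_at_top[of 0] by eventually_elim auto
    thus "\<forall>\<^sub>F n in sequentially. k \<le> N n"
    proof eventually_elim
      case (elim n)
      have "\<epsilon> / 2 * real n \<le> \<epsilon> * real n" using \<epsilon> by (intro mult_right_mono) auto
      thus ?case using N2[of n] elim by linarith
    qed
    thus "\<forall>\<^sub>F n in sequentially. q0 \<le> real (N n choose k) / real (n choose k)"
      using ev
    proof eventually_elim
      case (elim n)
      have "\<epsilon> / 2 \<le> (real (N n) - real k) / real n"
        using N2[of n] elim by (simp add: field_simps)
      hence "q0 \<le> ((real (N n) - real k) / real n) ^ k"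
        unfolding q0_def using \<epsilon> by (intro power_mono) auto
      also have "\<dots> \<le> real (N n choose k) / real (n choose k)"
        using elim \<open>\<And>n. N n \<le> n\<close> by (intro binomial_ratio_ge) auto
      finally show ?case .
    qed
    have "\<epsilon> * ln 2 < \<epsilon> * 1" using \<epsilon> ln_2_less_1 by (intro mult_strict_left_mono) auto
    also have "\<dots> = 1 / 18 * (1 / 2) / 2 ^ k" by (simp add: \<epsilon>_def)
    also have "\<dots> \<le> 1 / 18 * (1 - (1 - q0) ^ t) / 2 ^ k"
      using t by (intro divide_right_mono mult_left_mono) auto
    finally show "\<epsilon> * ln 2 < 1 / 18 * (1 - (1 - q0) ^ t) / 2 ^ k" .
  qed (use t0 q0 in auto)
  thus ?thesis
    unfolding threshold_lowerable_def
    using random_sat_whp_low_density[OF assms] is_strategy_choose_inside[OF t0]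
    by (intro exI[of _ t] exI[of _ "1/18"] exI[of _ "\<lambda>n _. choose_inside (N n)"]) auto
qed

section \<open>Second moment of the signed weight\<close>

definition sgn_in :: "nat set \<Rightarrow> nat \<Rightarrow> real" where
  "sgn_in A v = (if v \<in> A then 1 else - 1)"

definition lit_sgn :: "nat set \<Rightarrow> lit \<Rightarrow> real" where
  "lit_sgn A l = (if (fst l \<in> A) = snd l then - 1 else 1)"

abbreviation large_subsets :: "'a set \<Rightarrow> 'a set set" where
  "large_subsets V \<equiv> {S. S \<subseteq> V \<and> 3 \<le> card S}"

text \<open>The number of subsets with at least three elements of a \<open>k\<close>-set, see
  \<open>card_large_subsets\<close>.\<close>

definition num_large :: "nat \<Rightarrow> real" where
  "num_large k = 2 ^ k - 1 - real k - real (k choose 2)"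

definition large_sum :: "nat set \<Rightarrow> clause \<Rightarrow> real" where
  "large_sum A C = (\<Sum>S\<in>large_subsets C. \<Prod>l\<in>S. lit_sgn A l)"

definition weight :: "nat \<Rightarrow> nat set \<Rightarrow> clause \<Rightarrow> real" where
  "weight k A C = 1 - large_sum A C / num_large k"

text \<open>Passing to the complement is useful because sums of products over \<open>Pow V\<close>
  factor, and those over sets of size at most two are explicit.\<close>

lemma sum_large_subsets:
  fixes f :: "'a set \<Rightarrow> real"
  assumes "finite V"
  shows "(\<Sum>S\<in>large_subsets V. f S) =
         (\<Sum>S\<in>Pow V. f S) - f {} - (\<Sum>S | S \<subseteq> V \<and> card S = 1. f S) - (\<Sum>S | S \<subseteq> V \<and> card S = 2. f S)"
proof -
  let ?S = "\<lambda>j. {S. S \<subseteq> V \<and> card S = j}"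
  have fin: "finite {S. S \<subseteq> V \<and> P S}" for P by (rule finite_subset[of _ "Pow V"]) (use assms in auto)
  have 0: "?S 0 = {{}}" by (auto dest: finite_subset[OF _ assms])
  have "Pow V = large_subsets V \<union> (?S 0 \<union> (?S 1 \<union> ?S 2))"
    by (auto simp: numeral_3_eq_3 not_le less_Suc_eq numeral_2_eq_2 Suc_le_eq)
  hence "sum f (Pow V) = sum f (large_subsets V \<union> (?S 0 \<union> (?S 1 \<union> ?S 2)))" by simp
  also have "\<dots> = sum f (large_subsets V) + (sum f (?S 0) + (sum f (?S 1) + sum f (?S 2)))"
    by (subst sum.union_disjoint; (subst sum.union_disjoint)?; (subst sum.union_disjoint)?)
       (use fin in auto)
  finally show ?thesis by (simp add: 0)
qed

lemma card_large_subsets: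
  assumes "finite V"
  shows "real (card (large_subsets V)) = num_large (card V)"
  using sum_large_subsets[OF assms, of "\<lambda>_. 1"] assms
  by (simp add: num_large_def card_Pow n_subsets)

text \<open>If all literals are false, every product of literal signs is one, so the average over
  the large subsets is exactly one.\<close>

lemma weight_violated:
  assumes "violates A C" "finite C" "card C = k" "num_large k \<noteq> 0"
  shows "weight k A C = 0"
proof -
  have "lit_sgn A l = 1" if "l \<in> C" for l
    using assms(1) that by (auto simp: violates_def lit_sgn_def case_prod_beta)
  hence "large_sum A C = (\<Sum>S\<in>large_subsets C. 1)"
    unfolding large_sum_def by (intro sum.cong prod.neutral refl) auto
  also have "\<dots> = num_large k" using card_large_subsets[OF assms(2)] assms(3) by simp
  finally show ?thesis using assms(4) by (simp add: weight_def)
qed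

text \<open>Orthogonality of characters: the sum factors over \<open>V\<close>, and a variable in
  exactly one of \<open>S\<close> and \<open>S'\<close> contributes
  \<open>1 + (-1) = 0\<close>.\<close>

lemma sum_Pow_prod_sgn_in:
  assumes "finite V" "S \<subseteq> V" "S' \<subseteq> V"
  shows "(\<Sum>T\<in>Pow V. (\<Prod>v\<in>S. sgn_in T v) * (\<Prod>v\<in>S'. sgn_in T v)) = (if S = S' then 2 ^ card V else 0)"
proof -
  define h where "h = (\<lambda>v s. (if v \<in> S then s else 1) * (if v \<in> S' then s else (1::real)))"
  have "(\<Prod>v\<in>S. sgn_in T v) * (\<Prod>v\<in>S'. sgn_in T v) = (\<Prod>v\<in>T. h v 1) * (\<Prod>v\<in>V - T. h v (- 1))"
    if "T \<in> Pow V" for T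
  proof -
    have "(\<Prod>v\<in>S. sgn_in T v) * (\<Prod>v\<in>S'. sgn_in T v) = (\<Prod>v\<in>V. h v (sgn_in T v))"
      unfolding h_def prod.distrib using assms
      by (simp add: prod.If_cases Int_absorb1)
    also have "\<dots> = (\<Prod>v\<in>T. h v (sgn_in T v)) * (\<Prod>v\<in>V - T. h v (sgn_in T v))"
      using that assms(1) by (subst prod.subset_diff[of T V]) (auto simp: mult.commute)
    also have "(\<Prod>v\<in>T. h v (sgn_in T v)) = (\<Prod>v\<in>T. h v 1)"
      by (rule prod.cong) (auto simp: sgn_in_def)
    also have "(\<Prod>v\<in>V - T. h v (sgn_in T v)) = (\<Prod>v\<in>V - T. h v (- 1))"
      by (rule prod.cong) (auto simp: sgn_in_def)
    finally show ?thesis .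
  qed
  hence "(\<Sum>T\<in>Pow V. (\<Prod>v\<in>S. sgn_in T v) * (\<Prod>v\<in>S'. sgn_in T v)) = (\<Prod>v\<in>V. h v 1 + h v (- 1))"
    by (simp add: prod_add[OF assms(1)])
  also have "\<dots> = (if S = S' then 2 ^ card V else 0)"
  proof (cases "S = S'")
    case True
    have "(\<Prod>v\<in>V. h v 1 + h v (- 1)) = (\<Prod>v\<in>V. 2)"
      by (rule prod.cong) (auto simp: h_def True)
    thus ?thesis using True by simp
  next
    case False
    then obtain v where "v \<in> V" "(v \<in> S) \<noteq> (v \<in> S')" using assms by blast
    hence "h v 1 + h v (- 1) = 0" by (auto simp: h_def)
    hence "(\<Prod>v\<in>V. h v 1 + h v (- 1)) = 0" using \<open>v \<in> V\<close> assms(1) by (intro prod_zero) auto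
    thus ?thesis using False by simp
  qed
  finally show ?thesis .
qed

text \<open>The sign of a literal on \<open>v\<close> is \<open>- sgn_in A v * sgn_in T v\<close>.
  This separates the assignment from the clause and expands \<open>large_sum\<close> in the
  characters of \<open>T\<close>.\<close>

lemma large_sum_signed_clause:
  assumes "finite V"
  shows "large_sum A (signed_clause V T) =
         (\<Sum>S\<in>large_subsets V. (\<Prod>v\<in>S. - sgn_in A v) * (\<Prod>v\<in>S. sgn_in T v))"
proof -
  let ?f = "\<lambda>v. (v, v \<in> T)"
  have inj: "inj_on ?f X" for X by (auto simp: inj_on_def)
  have inj': "inj_on ((`) ?f) X" for X by (intro inj_on_image inj)
  have eq: "large_subsets (signed_clause V T) = (`) ?f ` large_subsets V"
    unfolding signed_clause_def
    by (auto simp: subset_image_iff card_image[OF inj] image_iff)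
  have "large_sum A (signed_clause V T) = (\<Sum>S\<in>large_subsets V. \<Prod>l\<in>?f ` S. lit_sgn A l)"
    unfolding large_sum_def eq by (subst sum.reindex[OF inj']) simp
  also have "\<dots> = (\<Sum>S\<in>large_subsets V. \<Prod>v\<in>S. - sgn_in A v * sgn_in T v)"
    by (rule sum.cong[OF refl], subst prod.reindex[OF inj])
       (auto simp: lit_sgn_def sgn_in_def intro!: prod.cong)
  finally show ?thesis by (simp only: prod.distrib)
qed

text \<open>No character in the expansion is constant. The empty product in the proof stands for the
  constant character, so that orthogonality applies.\<close>

lemma sum_Pow_large_sum:
  assumes "finite V"
  shows "(\<Sum>T\<in>Pow V. large_sum A (signed_clause V T)) = 0"
proof -
  have "(\<Sum>T\<in>Pow V. large_sum A (signed_clause V T)) =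
    (\<Sum>S\<in>large_subsets V. (\<Prod>v\<in>S. - sgn_in A v) * (\<Sum>T\<in>Pow V. (\<Prod>v\<in>S. sgn_in T v) * (\<Prod>v\<in>{}. sgn_in T v)))"
    unfolding large_sum_signed_clause[OF assms]
    by (subst sum.swap) (simp add: sum_distrib_left)
  also have "\<dots> = 0"
  proof (rule sum.neutral, rule ballI)
    fix S assume S: "S \<in> large_subsets V"
    hence "S \<noteq> {}" by auto
    thus "(\<Prod>v\<in>S. - sgn_in A v) * (\<Sum>T\<in>Pow V. (\<Prod>v\<in>S. sgn_in T v) * (\<Prod>v\<in>{}. sgn_in T v)) = 0"
      using S assms by (subst sum_Pow_prod_sgn_in) auto
  qed
  finally show ?thesis .
qed

text \<open>Parseval's identity: only the terms with \<open>S = S'\<close> survive, and there the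
  minus signs of the two assignments cancel.\<close>

lemma sum_Pow_large_sum_mult:
  assumes "finite V"
  shows "(\<Sum>T\<in>Pow V. large_sum A (signed_clause V T) * large_sum B (signed_clause V T)) =
         2 ^ card V * (\<Sum>S\<in>large_subsets V. \<Prod>v\<in>S. sgn_in A v * sgn_in B v)"
proof -
  let ?L = "large_subsets V"
  let ?a = "\<lambda>A S. \<Prod>v\<in>S. - sgn_in A v"
  let ?g = "\<lambda>T S. \<Prod>v\<in>S. sgn_in T v"
  have fin: "finite ?L" by (rule finite_subset[of _ "Pow V"]) (use assms in auto)
  have "(\<Sum>T\<in>Pow V. large_sum A (signed_clause V T) * large_sum B (signed_clause V T)) =
        (\<Sum>T\<in>Pow V. \<Sum>S\<in>?L. \<Sum>S'\<in>?L. ?a A S * ?a B S' * (?g T S * ?g T S'))"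
    unfolding large_sum_signed_clause[OF assms] sum_product
    by (intro sum.cong refl) (simp only: mult_ac)
  also have "\<dots> = (\<Sum>S\<in>?L. \<Sum>S'\<in>?L. \<Sum>T\<in>Pow V. ?a A S * ?a B S' * (?g T S * ?g T S'))"
    by (subst sum.swap, rule sum.cong[OF refl], rule sum.swap)
  also have "\<dots> = (\<Sum>S\<in>?L. \<Sum>S'\<in>?L. ?a A S * ?a B S' * (if S = S' then 2 ^ card V else 0))"
    unfolding sum_distrib_left[symmetric]
    by (intro sum.cong refl, subst sum_Pow_prod_sgn_in) (use assms in auto)
  also have "\<dots> = (\<Sum>S\<in>?L. ?a A S * ?a B S * 2 ^ card V)"
    by (intro sum.cong refl) (use fin in \<open>simp add: if_distrib[of "\<lambda>x. _ * x"] cong: if_cong\<close>)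
  also have "\<dots> = 2 ^ card V * (\<Sum>S\<in>?L. \<Prod>v\<in>S. sgn_in A v * sgn_in B v)"
    by (simp add: sum_distrib_left prod.distrib[symmetric] mult.commute)
  finally show ?thesis .
qed

section \<open>Averages over random variable sets and pair correlations\<close>

lemma card_supersets:
  assumes "S \<subseteq> {..<n}" "card S \<le> k"
  shows "card {V. S \<subseteq> V \<and> V \<subseteq> {..<n} \<and> card V = k} = (n - card S) choose (k - card S)"
proof -
  have finS: "finite S" using assms(1) finite_subset by blast
  have "bij_betw (\<lambda>W. W \<union> S) {W. W \<subseteq> {..<n} - S \<and> card W = k - card S}
           {V. S \<subseteq> V \<and> V \<subseteq> {..<n} \<and> card V = k}"
  proof (rule bij_betw_byWitness[where f' = "\<lambda>V. V - S"])
    show "(\<lambda>W. W \<union> S) ` {W. W \<subseteq> {..<n} - S \<and> card W = k - card S} \<subseteq>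
           {V. S \<subseteq> V \<and> V \<subseteq> {..<n} \<and> card V = k}"
    proof (rule image_subsetI)
      fix W assume W: "W \<in> {W. W \<subseteq> {..<n} - S \<and> card W = k - card S}"
      hence "finite W" using finite_subset by blast
      hence "card (W \<union> S) = card W + card S" using W finS by (intro card_Un_disjoint) auto
      thus "W \<union> S \<in> {V. S \<subseteq> V \<and> V \<subseteq> {..<n} \<and> card V = k}" using W assms by auto
    qed
    show "(\<lambda>V. V - S) ` {V. S \<subseteq> V \<and> V \<subseteq> {..<n} \<and> card V = k} \<subseteq>
            {W. W \<subseteq> {..<n} - S \<and> card W = k - card S}"
      using finS by (auto simp: card_Diff_subset)
  qed auto
  hence "card {V. S \<subseteq> V \<and> V \<subseteq> {..<n} \<and> card V = k} = card {W. W \<subseteq> {..<n} - S \<and> card W = k - card S}"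
    by (simp add: bij_betw_same_card)
  also have "\<dots> = card ({..<n} - S) choose (k - card S)" by (rule n_subsets) auto
  also have "card ({..<n} - S) = n - card S" using assms finS by (simp add: card_Diff_subset)
  finally show ?thesis .
qed

text \<open>Double counting: each \<open>j\<close>-set lies in the same number of
  \<open>k\<close>-sets.\<close>

lemma average_subsets:
  fixes f :: "nat set \<Rightarrow> real"
  assumes "j \<le> k" "k \<le> n"
  shows "(\<Sum>V | V \<subseteq> {..<n} \<and> card V = k. \<Sum>S | S \<subseteq> V \<and> card S = j. f S) / real (n choose k) =
         real (k choose j) * (\<Sum>S | S \<subseteq> {..<n} \<and> card S = j. f S) / real (n choose j)"
proof -
  let ?K = "{V. V \<subseteq> {..<n} \<and> card V = k}" and ?J = "{S. S \<subseteq> {..<n} \<and> card S = j}"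
  have fin: "finite ?K" "finite ?J" by (rule finite_subset[of _ "Pow {..<n}"]; auto)+
  have "(\<Sum>V\<in>?K. \<Sum>S | S \<subseteq> V \<and> card S = j. f S) = (\<Sum>V\<in>?K. \<Sum>S | S \<in> ?J \<and> S \<subseteq> V. f S)"
    by (intro sum.cong refl) auto
  also have "\<dots> = (\<Sum>S\<in>?J. \<Sum>V | V \<in> ?K \<and> S \<subseteq> V. f S)"
    by (rule sum.swap_restrict[OF fin])
  also have "\<dots> = (\<Sum>S\<in>?J. real ((n - j) choose (k - j)) * f S)"
  proof (rule sum.cong[OF refl])
    fix S assume S: "S \<in> ?J"
    have "{V. V \<in> ?K \<and> S \<subseteq> V} = {V. S \<subseteq> V \<and> V \<subseteq> {..<n} \<and> card V = k}" by auto
    hence "card {V. V \<in> ?K \<and> S \<subseteq> V} = (n - j) choose (k - j)"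
      using card_supersets[of S n k] S assms by simp
    thus "(\<Sum>V | V \<in> ?K \<and> S \<subseteq> V. f S) = real ((n - j) choose (k - j)) * f S" by simp
  qed
  finally have eq: "(\<Sum>V\<in>?K. \<Sum>S | S \<subseteq> V \<and> card S = j. f S) = real ((n - j) choose (k - j)) * sum f ?J"
    by (simp add: sum_distrib_left)
  have "(n choose k) * (k choose j) = (n choose j) * ((n - j) choose (k - j))"
    by (rule choose_mult[OF assms])
  hence "real (n choose k) * real (k choose j) = real (n choose j) * real ((n - j) choose (k - j))"
    by (simp flip: of_nat_mult)
  moreover have "real (n choose k) > 0" "real (n choose j) > 0" using assms by auto
  ultimately have "real ((n - j) choose (k - j)) = real (n choose k) * real (k choose j) / real (n choose j)"
    by (simp add: field_simps)
  thus ?thesis using \<open>real (n choose k) > 0\<close> unfolding eq by simp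
qed

lemma sum_singletons:
  fixes f :: "'a set \<Rightarrow> real"
  shows "(\<Sum>S | S \<subseteq> V \<and> card S = 1. f S) = (\<Sum>v\<in>V. f {v})"
proof -
  have "{S. S \<subseteq> V \<and> card S = 1} = (\<lambda>v. {v}) ` V" by (auto simp: card_1_singleton_iff)
  thus ?thesis by (simp add: sum.reindex)
qed

lemma sum_pairs_prod:
  fixes x :: "'a \<Rightarrow> real"
  assumes "finite V"
  shows "2 * (\<Sum>S | S \<subseteq> V \<and> card S = 2. \<Prod>v\<in>S. x v) = (\<Sum>v\<in>V. x v) ^ 2 - (\<Sum>v\<in>V. x v ^ 2)"
  using assms
proof (induction V)
  case (insert z V)
  let ?P = "{S. S \<subseteq> V \<and> card S = 2}"
  have fin: "finite ?P" by (rule finite_subset[of _ "Pow V"]) (use insert in auto)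
  have eq: "{S. S \<subseteq> insert z V \<and> card S = 2} = ?P \<union> (\<lambda>v. {z, v}) ` V"
  proof
    show "{S. S \<subseteq> insert z V \<and> card S = 2} \<subseteq> ?P \<union> (\<lambda>v. {z, v}) ` V"
    proof
      fix S assume "S \<in> {S. S \<subseteq> insert z V \<and> card S = 2}"
      then obtain a b where "S = {a, b}" "a \<noteq> b" "a \<in> insert z V" "b \<in> insert z V"
        by (auto simp: card_2_iff)
      thus "S \<in> ?P \<union> (\<lambda>v. {z, v}) ` V" by auto
    qed
    show "?P \<union> (\<lambda>v. {z, v}) ` V \<subseteq> {S. S \<subseteq> insert z V \<and> card S = 2}"
      using insert.hyps by (auto simp: card_insert_if)
  qed
  have inj: "inj_on (\<lambda>v. {z, v}) V" by (auto simp: inj_on_def doubleton_eq_iff)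
  have "(\<Sum>S | S \<subseteq> insert z V \<and> card S = 2. \<Prod>v\<in>S. x v) =
        (\<Sum>S\<in>?P. \<Prod>v\<in>S. x v) + (\<Sum>S\<in>(\<lambda>v. {z, v}) ` V. \<Prod>v\<in>S. x v)"
    unfolding eq by (rule sum.union_disjoint) (use fin insert.hyps in auto)
  also have "(\<Sum>S\<in>(\<lambda>v. {z, v}) ` V. \<Prod>v\<in>S. x v) = (\<Sum>v\<in>V. \<Prod>u\<in>{z, v}. x u)"
    by (subst sum.reindex[OF inj]) simp
  also have "\<dots> = (\<Sum>v\<in>V. x z * x v)"
  proof (rule sum.cong[OF refl])
    fix v assume "v \<in> V"
    hence "z \<noteq> v" using insert.hyps by auto
    thus "(\<Prod>u\<in>{z, v}. x u) = x z * x v" by simp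
  qed
  also have "(\<Sum>v\<in>V. x z * x v) = x z * (\<Sum>v\<in>V. x v)" by (simp add: sum_distrib_left)
  finally show ?case using insert by (simp add: power2_eq_square algebra_simps)
qed simp

text \<open>
  For two assignments agreeing on \<open>a\<close> of the \<open>n\<close> variables, \<open>s\<close> is the sum of the agreement signs
  \<open>\<plusminus>1\<close>. The subtracted terms are the averages over a random clause of the products of these signs
  over the subsets of size zero, one and two; the first term is the average over all subsets.
\<close>

definition overlap_term :: "nat \<Rightarrow> nat \<Rightarrow> nat \<Rightarrow> real" where
  "overlap_term n k a = (let s = 2 * real a - real n in
     2 ^ k * (real (a choose k) / real (n choose k)) - 1 - real k * s / real n
       - real (k choose 2) * (s\<^sup>2 - real n) / (real n * (real n - 1)))"

text \<open>\<open>D\<close> is meant as the set of variables on which two assignments agree. The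
  sum over all subsets of \<open>V\<close> is a product of factors \<open>1 + sgn_in D v\<close>,
  hence nonzero only for \<open>V \<subseteq> D\<close>; sizes one and two reduce to power sums of
  the signs.\<close>

lemma average_large_subsets:
  assumes "2 \<le> k" "k \<le> n" "D \<subseteq> {..<n}"
  shows "(\<Sum>V | V \<subseteq> {..<n} \<and> card V = k. \<Sum>S\<in>large_subsets V. \<Prod>v\<in>S. sgn_in D v) / real (n choose k) =
         overlap_term n k (card D)"
proof -
  let ?K = "{V. V \<subseteq> {..<n} \<and> card V = k}"
  let ?g = "\<lambda>S. \<Prod>v\<in>S. sgn_in D v"
  define s where "s = 2 * real (card D) - real n"
  have fin: "finite V" if "V \<in> ?K" for V using that finite_subset by auto
  have finK: "finite ?K" by (rule finite_subset[of _ "Pow {..<n}"]) auto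
  have n: "real n > 0" "real n - 1 > 0" "real (n choose k) > 0" using assms by auto
  have s: "(\<Sum>v<n. sgn_in D v) = s"
  proof -
    have "(\<Sum>v<n. sgn_in D v) = (\<Sum>v<n. 2 * of_bool (v \<in> D) - 1)"
      by (rule sum.cong) (auto simp: sgn_in_def)
    also have "\<dots> = 2 * (\<Sum>v<n. of_bool (v \<in> D)) - real n"
      by (simp add: sum_subtractf sum_distrib_left)
    also have "(\<Sum>v<n. of_bool (v \<in> D)) = real (card ({..<n} \<inter> {v. v \<in> D}))"
      by (subst sum_of_bool_eq) auto
    also have "{..<n} \<inter> {v. v \<in> D} = D" using assms by auto
    finally show ?thesis by (simp add: s_def)
  qed
  have all: "(\<Sum>S\<in>Pow V. ?g S) = 2 ^ k * of_bool (V \<subseteq> D)" if V: "V \<in> ?K" for V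
  proof -
    have "(\<Sum>S\<in>Pow V. ?g S) = (\<Prod>v\<in>V. sgn_in D v + 1)"
      by (simp add: prod_add[OF fin[OF V]])
    also have "\<dots> = 2 ^ k * of_bool (V \<subseteq> D)"
    proof (cases "V \<subseteq> D")
      case True
      have "(\<Prod>v\<in>V. sgn_in D v + 1) = (\<Prod>v\<in>V. 2)" using True by (intro prod.cong) (auto simp: sgn_in_def)
      thus ?thesis using True V by simp
    next
      case False
      then obtain v where "v \<in> V" "v \<notin> D" by auto
      hence "(\<Prod>v\<in>V. sgn_in D v + 1) = 0" using fin[OF V] by (intro prod_zero bexI[of _ v]) (auto simp: sgn_in_def)
      thus ?thesis using False by simp
    qed
    finally show ?thesis .
  qed
  have "(\<Sum>V\<in>?K. \<Sum>S\<in>large_subsets V. ?g S) / real (n choose k) =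
     (\<Sum>V\<in>?K. 2 ^ k * of_bool (V \<subseteq> D)) / real (n choose k) - (\<Sum>V\<in>?K. 1) / real (n choose k)
     - (\<Sum>V\<in>?K. \<Sum>S | S \<subseteq> V \<and> card S = 1. ?g S) / real (n choose k)
     - (\<Sum>V\<in>?K. \<Sum>S | S \<subseteq> V \<and> card S = 2. ?g S) / real (n choose k)"
    unfolding diff_divide_distrib[symmetric] sum_subtractf[symmetric]
  proof (intro arg_cong2[of _ _ _ _ "(/)"] refl sum.cong)
    fix V assume V: "V \<in> ?K"
    show "(\<Sum>S\<in>large_subsets V. ?g S) = 2 ^ k * of_bool (V \<subseteq> D) - 1 -
       (\<Sum>S | S \<subseteq> V \<and> card S = 1. ?g S) - (\<Sum>S | S \<subseteq> V \<and> card S = 2. ?g S)"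
      unfolding sum_large_subsets[OF fin[OF V]] all[OF V] by simp
  qed
  also have "(\<Sum>V\<in>?K. 2 ^ k * of_bool (V \<subseteq> D)) = 2 ^ k * real (card D choose k)"
  proof -
    have "(\<Sum>V\<in>?K. of_bool (V \<subseteq> D) :: real) = real (card (?K \<inter> {V. V \<subseteq> D}))"
      by (subst sum_of_bool_eq) (use finK in auto)
    also have "?K \<inter> {V. V \<subseteq> D} = {V. V \<subseteq> D \<and> card V = k}" using assms by auto
    also have "card \<dots> = card D choose k" using assms finite_subset by (intro n_subsets) auto
    finally show ?thesis by (simp flip: sum_distrib_left)
  qed
  also have "(\<Sum>V\<in>?K. 1) / real (n choose k) = 1" using n by (simp add: n_subsets)
  also have "(\<Sum>V\<in>?K. \<Sum>S | S \<subseteq> V \<and> card S = 1. ?g S) / real (n choose k) = real k * s / real n"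
    using assms by (subst average_subsets) (auto simp: sum_singletons[simplified] s)
  also have "(\<Sum>V\<in>?K. \<Sum>S | S \<subseteq> V \<and> card S = 2. ?g S) / real (n choose k) =
     real (k choose 2) * ((s\<^sup>2 - real n) / 2) / real (n choose 2)"
  proof -
    have "sgn_in D v ^ 2 = 1" for v by (simp add: sgn_in_def)
    hence "(\<Sum>v<n. sgn_in D v ^ 2) = real n" by simp
    hence eq: "(\<Sum>S | S \<subseteq> {..<n} \<and> card S = 2. ?g S) = (s\<^sup>2 - real n) / 2"
      using sum_pairs_prod[of "{..<n}" "sgn_in D"] s by simp
    show ?thesis by (simp only: average_subsets[OF assms(1,2)] eq)
  qed
  also have "real (n choose 2) = real n * (real n - 1) / 2"
    using choose_two[of n] assms by (simp add: real_of_nat_div of_nat_diff)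
  finally show ?thesis using n by (simp add: overlap_term_def Let_def s_def)
qed

lemma expectation_weight:
  assumes "k \<le> n"
  shows "measure_pmf.expectation (pmf_of_set (k_clauses n k)) (weight k A) = 1"
proof -
  let ?K = "{V. V \<subseteq> {..<n} \<and> card V = k}"
  have fin: "finite V" if "V \<in> ?K" for V using that finite_subset by auto
  have "measure_pmf.expectation (pmf_of_set (k_clauses n k)) (weight k A) = (\<Sum>V\<in>?K. 1) / real (n choose k)"
    unfolding expectation_clause[OF assms]
  proof (intro arg_cong2[of _ _ _ _ "(/)"] refl sum.cong)
    fix V assume V: "V \<in> ?K"
    have "(\<Sum>T\<in>Pow V. weight k A (signed_clause V T)) =
          2 ^ k - (\<Sum>T\<in>Pow V. large_sum A (signed_clause V T)) / num_large k"
      using fin[OF V] V by (simp add: weight_def sum_subtractf card_Pow sum_divide_distrib)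
    thus "(\<Sum>T\<in>Pow V. weight k A (signed_clause V T)) / 2 ^ k = 1"
      by (simp add: sum_Pow_large_sum[OF fin[OF V]])
  qed
  thus ?thesis using assms by (simp add: n_subsets)
qed

text \<open>The linear terms average to zero, and Parseval leaves the products of
  \<open>sgn_in A v * sgn_in B v\<close>, which is one exactly where the assignments agree.\<close>

lemma expectation_weight_mult:
  assumes "2 \<le> k" "k \<le> n"
  shows "measure_pmf.expectation (pmf_of_set (k_clauses n k)) (\<lambda>C. weight k A C * weight k B C) =
         1 + overlap_term n k (card {v. v < n \<and> (v \<in> A) = (v \<in> B)}) / (num_large k)\<^sup>2"
proof -
  let ?K = "{V. V \<subseteq> {..<n} \<and> card V = k}"
  let ?N = "num_large k"
  let ?D = "{v. v < n \<and> (v \<in> A) = (v \<in> B)}"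
  have fin: "finite V" if "V \<in> ?K" for V using that finite_subset by auto
  have "measure_pmf.expectation (pmf_of_set (k_clauses n k)) (\<lambda>C. weight k A C * weight k B C) =
        (\<Sum>V\<in>?K. 1 + (\<Sum>S\<in>large_subsets V. \<Prod>v\<in>S. sgn_in ?D v) / ?N\<^sup>2) / real (n choose k)"
    unfolding expectation_clause[OF assms(2)]
  proof (intro arg_cong2[of _ _ _ _ "(/)"] refl sum.cong)
    fix V assume V: "V \<in> ?K"
    have cV: "card (Pow V) = 2 ^ k" using V fin[OF V] by (simp add: card_Pow)
    have "(\<Sum>T\<in>Pow V. weight k A (signed_clause V T) * weight k B (signed_clause V T)) =
          (\<Sum>T\<in>Pow V. 1 - large_sum A (signed_clause V T) / ?N - large_sum B (signed_clause V T) / ?N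
             + large_sum A (signed_clause V T) * large_sum B (signed_clause V T) / ?N\<^sup>2)"
      by (intro sum.cong refl) (simp add: weight_def algebra_simps power2_eq_square)
    also have "\<dots> = 2 ^ k - (\<Sum>T\<in>Pow V. large_sum A (signed_clause V T)) / ?N
             - (\<Sum>T\<in>Pow V. large_sum B (signed_clause V T)) / ?N
             + (\<Sum>T\<in>Pow V. large_sum A (signed_clause V T) * large_sum B (signed_clause V T)) / ?N\<^sup>2"
      using cV by (simp add: sum_subtractf sum.distrib sum_divide_distrib)
    also have "\<dots> = 2 ^ k + 2 ^ k * (\<Sum>S\<in>large_subsets V. \<Prod>v\<in>S. sgn_in A v * sgn_in B v) / ?N\<^sup>2"
      using V by (simp add: sum_Pow_large_sum[OF fin[OF V]] sum_Pow_large_sum_mult[OF fin[OF V]])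
    also have "(\<Sum>S\<in>large_subsets V. \<Prod>v\<in>S. sgn_in A v * sgn_in B v) = (\<Sum>S\<in>large_subsets V. \<Prod>v\<in>S. sgn_in ?D v)"
    proof (intro sum.cong prod.cong refl)
      fix S v assume "S \<in> large_subsets V" "v \<in> S"
      hence "v < n" using V by auto
      thus "sgn_in A v * sgn_in B v = sgn_in ?D v" by (auto simp: sgn_in_def)
    qed
    finally show "(\<Sum>T\<in>Pow V. weight k A (signed_clause V T) * weight k B (signed_clause V T)) / 2 ^ k =
        1 + (\<Sum>S\<in>large_subsets V. \<Prod>v\<in>S. sgn_in ?D v) / ?N\<^sup>2"
      by (simp add: add_divide_distrib)
  qed
  also have "\<dots> = 1 + ((\<Sum>V\<in>?K. \<Sum>S\<in>large_subsets V. \<Prod>v\<in>S. sgn_in ?D v) / real (n choose k)) / ?N\<^sup>2"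
    using assms by (simp add: sum.distrib n_subsets add_divide_distrib sum_divide_distrib[symmetric])
  also have "(\<Sum>V\<in>?K. \<Sum>S\<in>large_subsets V. \<Prod>v\<in>S. sgn_in ?D v) / real (n choose k) = overlap_term n k (card ?D)"
    by (rule average_large_subsets[OF assms]) auto
  finally show ?thesis .
qed

section \<open>Chebyshev's inequality for the total weight\<close>

lemma satisfiable_if_weight:
  assumes "\<And>C. C \<in> set F \<Longrightarrow> weight k A C \<noteq> 0" "set F \<subseteq> k_clauses n k" "num_large k \<noteq> 0"
  shows "satisfiable F"
  unfolding satisfiable_def
proof (intro exI[of _ "\<lambda>v. v \<in> A"] ballI)
  fix C assume C: "C \<in> set F"
  have "C \<in> k_clauses n k" using C assms by auto
  hence "finite C" "card C = k"
    by (auto simp: k_clauses_def intro: finite_subset[of _ "{..<n} \<times> UNIV"])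
  hence "\<not> violates A C" using assms(1)[OF C] weight_violated assms(3) by blast
  thus "\<exists>(v, b)\<in>C. (v \<in> A) = b" by (auto simp: violates_def)
qed

lemma sum_Pow_card:
  fixes f :: "nat \<Rightarrow> real"
  shows "(\<Sum>D\<in>Pow {..<n}. f (card D)) = (\<Sum>a\<le>n. real (n choose a) * f a)"
proof -
  have "(\<Sum>D\<in>Pow {..<n}. f (card D)) = (\<Sum>a\<in>{..n}. \<Sum>D | D \<in> Pow {..<n} \<and> card D = a. f (card D))"
  proof (rule sum.group[symmetric])
    show "card ` Pow {..<n} \<subseteq> {..n}" using card_mono[of "{..<n}"] by fastforce
  qed auto
  also have "\<dots> = (\<Sum>a\<le>n. real (n choose a) * f a)"
    by (intro sum.cong refl) (simp add: n_subsets)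
  finally show ?thesis .
qed

text \<open>The second moment of the total weight of all assignments divided by the square of its
  mean, with pairs of assignments sorted by the number \<open>a\<close> of variables on which they
  agree.\<close>

definition second_moment_ratio :: "nat \<Rightarrow> nat \<Rightarrow> nat \<Rightarrow> real" where
  "second_moment_ratio n k m =
     (\<Sum>a\<le>n. real (n choose a) / 2 ^ n * (1 + overlap_term n k a / (num_large k)\<^sup>2) ^ m)"

text \<open>The total weight \<open>X\<close> has mean \<open>2 ^ n\<close> and vanishes on
  unsatisfiable formulas, so there \<open>(X F / 2 ^ n - 1)\<^sup>2\<close> equals one. Its
  expectation therefore bounds the failure probability, and this expectation is the ratio minus
  one.\<close>

lemma prob_random_satisfiable_ge:
  assumes "2 \<le> k" "k \<le> n" "num_large k \<noteq> 0"
  shows "measure_pmf.prob (random_formula k n m) {F. satisfiable F} \<ge> 2 - second_moment_ratio n k m"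
proof -
  let ?U = "pmf_of_set (k_clauses n k)"
  let ?P = "random_formula k n m"
  let ?g = "\<lambda>a. (1 + overlap_term n k a / (num_large k)\<^sup>2) ^ m"
  have ne: "k_clauses n k \<noteq> {}" by (rule k_clauses_nonempty[OF assms(2)])
  have finU: "finite (set_pmf ?U)" using ne by (simp add: finite_k_clauses)
  have finP: "finite (set_pmf ?P)" unfolding random_formula_def by (rule finite_set_replicate_pmf[OF finU])
  have int: "integrable (measure_pmf ?P) f" for f :: "formula \<Rightarrow> real"
    by (rule integrable_measure_pmf_finite[OF finP])
  define X where "X = (\<lambda>F::formula. \<Sum>A\<in>Pow {..<n}. \<Prod>i<m. weight k A (F ! i))"
  have EX: "measure_pmf.expectation ?P X = 2 ^ n"
  proof -
    have "measure_pmf.expectation ?P X = (\<Sum>A\<in>Pow {..<n}. measure_pmf.expectation ?P (\<lambda>F. \<Prod>i<m. weight k A (F ! i)))"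
      unfolding X_def by (rule Bochner_Integration.integral_sum) (rule int)
    also have "\<dots> = (\<Sum>A\<in>Pow {..<n}. \<Prod>i<m. measure_pmf.expectation ?U (weight k A))"
      unfolding random_formula_def by (intro sum.cong refl expectation_replicate_pmf_prod[OF finU])
    finally show ?thesis by (simp add: expectation_weight[OF assms(2)] card_Pow)
  qed
  have EX2: "measure_pmf.expectation ?P (\<lambda>F. X F ^ 2) = 4 ^ n * second_moment_ratio n k m"
  proof -
    have "measure_pmf.expectation ?P (\<lambda>F. X F ^ 2) =
       measure_pmf.expectation ?P (\<lambda>F. \<Sum>A\<in>Pow {..<n}. \<Sum>B\<in>Pow {..<n}. \<Prod>i<m. weight k A (F ! i) * weight k B (F ! i))"
      unfolding X_def power2_eq_square sum_product prod.distrib ..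
    also have "\<dots> = (\<Sum>A\<in>Pow {..<n}. \<Sum>B\<in>Pow {..<n}.
        measure_pmf.expectation ?P (\<lambda>F. \<Prod>i<m. weight k A (F ! i) * weight k B (F ! i)))"
      by (subst Bochner_Integration.integral_sum, rule int, rule sum.cong[OF refl],
          subst Bochner_Integration.integral_sum, rule int, rule refl)
    also have "\<dots> = (\<Sum>A\<in>Pow {..<n}. \<Sum>B\<in>Pow {..<n}. \<Prod>i<m. measure_pmf.expectation ?U (\<lambda>C. weight k A C * weight k B C))"
      unfolding random_formula_def
      by (intro sum.cong refl expectation_replicate_pmf_prod[OF finU, where f = "\<lambda>_ C. weight k _ C * weight k _ C"])
    also have "\<dots> = (\<Sum>A\<in>Pow {..<n}. \<Sum>B\<in>Pow {..<n}. ?g (card {v. v < n \<and> (v \<in> A) = (v \<in> B)}))"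
      by (simp add: expectation_weight_mult[OF assms(1,2)])
    also have "\<dots> = (\<Sum>A\<in>Pow {..<n}. \<Sum>D\<in>Pow {..<n}. ?g (card D))"
    proof (rule sum.cong[OF refl])
      fix A :: "nat set"
      \<comment> \<open>Agreement with a fixed \<open>A\<close> is an involution of
        \<open>Pow {..<n}\<close>, so the sum over \<open>B\<close> becomes a sum over agreement
        sets.\<close>
      have "bij_betw (\<lambda>B. {v. v < n \<and> (v \<in> A) = (v \<in> B)}) (Pow {..<n}) (Pow {..<n})"
        by (rule bij_betw_byWitness[where f' = "\<lambda>B. {v. v < n \<and> (v \<in> A) = (v \<in> B)}"]) auto
      from sum.reindex_bij_betw[OF this, of "\<lambda>D. ?g (card D)"]
      show "(\<Sum>B\<in>Pow {..<n}. ?g (card {v. v < n \<and> (v \<in> A) = (v \<in> B)})) = (\<Sum>D\<in>Pow {..<n}. ?g (card D))" .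
    qed
    also have "\<dots> = 2 ^ n * (\<Sum>a\<le>n. real (n choose a) * ?g a)"
      unfolding sum_Pow_card[of ?g n] by (simp add: card_Pow)
    also have "(\<Sum>a\<le>n. real (n choose a) * ?g a) = 2 ^ n * second_moment_ratio n k m"
      by (simp add: second_moment_ratio_def sum_distrib_left)
    finally show ?thesis by (simp add: power_mult_distrib[symmetric])
  qed
  have "measure_pmf.prob ?P (UNIV - {F. satisfiable F}) \<le>
        measure_pmf.expectation ?P (\<lambda>F. (X F / 2 ^ n - 1) ^ 2)"
    unfolding prob_eq_expectation
  proof (rule integral_mono_AE[OF int int])
    show "AE F in measure_pmf ?P. of_bool (F \<in> UNIV - {F. satisfiable F}) \<le> (X F / 2 ^ n - 1) ^ 2"
      unfolding AE_measure_pmf_iff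
    proof
      fix F assume F: "F \<in> set_pmf ?P"
      show "of_bool (F \<in> UNIV - {F. satisfiable F}) \<le> (X F / 2 ^ n - 1) ^ 2"
      proof (cases "satisfiable F")
        case False
        have len: "length F = m" and FU: "set F \<subseteq> k_clauses n k"
          using F ne by (auto simp: random_formula_def set_replicate_pmf finite_k_clauses)
        have "(\<Prod>i<m. weight k A (F ! i)) = 0" for A
        proof -
          obtain C where "C \<in> set F" "weight k A C = 0"
            using satisfiable_if_weight[OF _ FU assms(3)] False by blast
          thus ?thesis using len by (auto simp: in_set_conv_nth)
        qed
        hence "X F = 0" unfolding X_def by (intro sum.neutral ballI)
        thus ?thesis by simp
      qed simp
    qed
  qed
  also have "\<dots> = measure_pmf.expectation ?P (\<lambda>F. X F ^ 2 / 4 ^ n - 2 * X F / 2 ^ n + 1)"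
  proof -
    have p: "((2::real) ^ n)\<^sup>2 = 4 ^ n" by (simp add: power2_eq_square flip: power_mult_distrib)
    show ?thesis unfolding power2_diff power_divide p by (simp add: algebra_simps)
  qed
  also have "\<dots> = measure_pmf.expectation ?P (\<lambda>F. X F ^ 2) / 4 ^ n - 2 * measure_pmf.expectation ?P X / 2 ^ n + 1"
    by (simp add: int)
  also have "\<dots> = second_moment_ratio n k m - 1" by (simp add: EX EX2)
  finally have "measure_pmf.prob ?P (UNIV - {F. satisfiable F}) \<le> second_moment_ratio n k m - 1" .
  moreover have "measure_pmf.prob ?P (UNIV - {F. satisfiable F}) = 1 - measure_pmf.prob ?P {F. satisfiable F}"
    using measure_pmf.prob_compl[of "{F. satisfiable F}" ?P] by simp
  ultimately show ?thesis by simp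
qed

section \<open>Asymptotics of the second moment\<close>

text \<open>The overlap \<rho> of two assignments that agree on \<open>a\<close> of the
  \<open>n\<close> variables, that is, the mean of their agreement signs.\<close>

definition bias :: "nat \<Rightarrow> nat \<Rightarrow> real" where
  "bias n a = (2 * real a - real n) / real n"

text \<open>
  The limit of \<^const>\<open>overlap_term\<close> as \<open>n\<close> grows with \<open>\<rho>\<close> fixed, namely \<open>\<Sum>j\<ge>3. (k choose j) \<rho> ^ j\<close>.
\<close>

definition taylor3 :: "nat \<Rightarrow> real \<Rightarrow> real" where
  "taylor3 k \<rho> = (1 + \<rho>) ^ k - 1 - real k * \<rho> - real (k choose 2) * \<rho>\<^sup>2"

text \<open>This recurrence drives the sign and size bounds below. The one for
  \<open>num_large\<close> is its case \<rho> = 1.\<close>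

lemma taylor3_Suc: "taylor3 (Suc k) \<rho> = (1 + \<rho>) * taylor3 k \<rho> + real (k choose 2) * \<rho> ^ 3"
proof -
  have "Suc k choose 2 = k + (k choose 2)" by (simp add: numeral_2_eq_2)
  thus ?thesis by (simp add: taylor3_def power2_eq_square power3_eq_cube algebra_simps)
qed

lemma num_large_Suc: "num_large (Suc k) = 2 * num_large k + real (k choose 2)"
proof -
  have "Suc k choose 2 = k + (k choose 2)" by (simp add: numeral_2_eq_2)
  thus ?thesis by (simp add: num_large_def)
qed

lemma num_large_nonneg: "num_large k \<ge> 0"
  by (induction k) (simp add: num_large_def, simp add: num_large_Suc)

text \<open>Both terms of the recurrence are nonpositive, the second because the cube is odd.
  Negative overlaps thus do not increase the limiting correlation.\<close>

lemma taylor3_nonpos: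
  assumes "-1 \<le> \<rho>" "\<rho> \<le> 0"
  shows "taylor3 k \<rho> \<le> 0"
proof (induction k)
  case (Suc k)
  have "(1 + \<rho>) * taylor3 k \<rho> \<le> 0" using assms Suc by (intro mult_nonneg_nonpos) auto
  moreover have "real (k choose 2) * \<rho> ^ 3 \<le> 0" using assms by (intro mult_nonneg_nonpos) (auto simp: power_le_zero_eq)
  ultimately show ?case by (simp add: taylor3_Suc)
qed (simp add: taylor3_def)

text \<open>The recurrences of \<open>taylor3\<close> and \<open>num_large\<close> are compared term
  by term, using \<open>\<bar>1 + \<rho>\<bar> \<le> 2\<close>.\<close>

lemma abs_taylor3_le:
  assumes "\<bar>\<rho>\<bar> \<le> 1"
  shows "\<bar>taylor3 k \<rho>\<bar> \<le> num_large k * \<bar>\<rho>\<bar> ^ 3"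
proof (induction k)
  case (Suc k)
  have "\<bar>taylor3 (Suc k) \<rho>\<bar> \<le> \<bar>1 + \<rho>\<bar> * \<bar>taylor3 k \<rho>\<bar> + real (k choose 2) * \<bar>\<rho>\<bar> ^ 3"
    unfolding taylor3_Suc by (rule order_trans[OF abs_triangle_ineq]) (simp add: abs_mult power_abs)
  also have "\<dots> \<le> 2 * (num_large k * \<bar>\<rho>\<bar> ^ 3) + real (k choose 2) * \<bar>\<rho>\<bar> ^ 3"
    using assms Suc by (intro add_right_mono mult_mono) auto
  finally show ?case by (simp add: num_large_Suc algebra_simps)
qed (simp add: taylor3_def num_large_def binomial_eq_0)

text \<open>Splits off the limit \<open>taylor3\<close>. The other terms are corrections for finite
  \<open>n\<close>: one from drawing distinct variables, one from the subtracted terms of degree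
  two.\<close>

lemma overlap_term_bias:
  assumes "n \<ge> 2"
  shows "overlap_term n k a = 2 ^ k * (real (a choose k) / real (n choose k)) - (1 + bias n a) ^ k
           + taylor3 k (bias n a) + real (k choose 2) * (1 - (bias n a)\<^sup>2) / (real n - 1)"
proof -
  define \<rho> where "\<rho> = bias n a"
  have n: "real n > 0" "real n - 1 > 0" using assms by auto
  have s: "2 * real a - real n = real n * \<rho>" using n by (simp add: \<rho>_def bias_def)
  have "((real n * \<rho>)\<^sup>2 - real n) / (real n * (real n - 1)) = (real n * \<rho>\<^sup>2 - 1) / (real n - 1)"
  proof -
    have "(real n * \<rho>)\<^sup>2 - real n = real n * (real n * \<rho>\<^sup>2 - 1)" by (simp add: power2_eq_square algebra_simps)
    thus ?thesis using n by simp
  qed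
  also have "\<dots> = \<rho>\<^sup>2 - (1 - \<rho>\<^sup>2) / (real n - 1)" using n by (simp add: field_simps)
  finally have e: "((real n * \<rho>)\<^sup>2 - real n) / (real n * (real n - 1)) = \<rho>\<^sup>2 - (1 - \<rho>\<^sup>2) / (real n - 1)" .
  have "overlap_term n k a = 2 ^ k * (real (a choose k) / real (n choose k)) - 1 - real k * \<rho>
       - real (k choose 2) * (((real n * \<rho>)\<^sup>2 - real n) / (real n * (real n - 1)))"
    using n by (simp add: overlap_term_def Let_def s)
  thus ?thesis unfolding e \<rho>_def[symmetric] by (simp add: taylor3_def algebra_simps)
qed

lemma bias_bounds:
  assumes "a \<le> n" "n > 0"
  shows "- 1 \<le> bias n a" "bias n a \<le> 1"
  using assms by (auto simp: bias_def field_simps)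

lemma one_plus_bias: "n > 0 \<Longrightarrow> 1 + bias n a = 2 * (real a / real n)"
  by (simp add: bias_def field_simps)

lemma overlap_term_le:
  assumes "n \<ge> 2" "k \<le> n" "a \<le> n"
  shows "overlap_term n k a \<le> taylor3 k (bias n a) + real (k choose 2) / (real n - 1)"
proof -
  have "2 ^ k * (real (a choose k) / real (n choose k)) \<le> 2 ^ k * (real a / real n) ^ k"
    using assms by (intro mult_left_mono binomial_ratio_le) auto
  also have "\<dots> = (1 + bias n a) ^ k" using assms by (simp add: one_plus_bias power_mult_distrib power_divide)
  finally have "2 ^ k * (real (a choose k) / real (n choose k)) \<le> (1 + bias n a) ^ k" .
  moreover have "real (k choose 2) * (1 - (bias n a)\<^sup>2) / (real n - 1) \<le> real (k choose 2) * 1 / (real n - 1)"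
    using assms by (intro divide_right_mono mult_left_mono) auto
  ultimately show ?thesis using overlap_term_bias[OF assms(1)] by simp
qed

text \<open>Together with the bound on \<open>1 + real k + real (k choose 2)\<close> in
  \<open>large_k\<close>, this keeps the base of the power in \<open>second_moment_ratio\<close>
  nonnegative, so that it can be bounded by monotonicity.\<close>

lemma overlap_term_ge:
  assumes "n \<ge> 2" "a \<le> n"
  shows "overlap_term n k a \<ge> - 1 - real k - real (k choose 2)"
proof -
  define \<rho> where "\<rho> = bias n a"
  have \<rho>: "\<bar>\<rho>\<bar> \<le> 1" using bias_bounds[of a n] assms by (auto simp: \<rho>_def)
  have sq: "\<rho>\<^sup>2 \<le> 1" using \<rho> by (simp add: abs_square_le_1)
  have "taylor3 k \<rho> - (1 + \<rho>) ^ k \<ge> - 1 - real k - real (k choose 2)"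
  proof -
    have "real k * \<rho> \<le> real k * 1" using \<rho> by (intro mult_left_mono) auto
    moreover have "real (k choose 2) * \<rho>\<^sup>2 \<le> real (k choose 2) * 1" using sq by (intro mult_left_mono) auto
    ultimately show ?thesis by (simp add: taylor3_def)
  qed
  moreover have "0 \<le> real (k choose 2) * (1 - \<rho>\<^sup>2) / (real n - 1)" using sq assms by auto
  moreover have "0 \<le> 2 ^ k * (real (a choose k) / real (n choose k))" by simp
  ultimately show ?thesis unfolding overlap_term_bias[OF assms(1)] \<rho>_def[symmetric] by linarith
qed

text \<open>Each factor \<open>2 (a - i) / (n - i)\<close> falls short of \<open>1 + \<rho>\<close>
  by at least \<open>i (1 - \<rho>) / n\<close>, and these deficits add up to the exponent. Unlike
  \<open>binomial_ratio_le\<close>, this keeps the gain of order \<open>1/n\<close> that the central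
  range requires.\<close>

lemma binomial_ratio_exp_le:
  assumes "a > 0" "a \<le> n"
  defines "\<rho> \<equiv> bias n a"
  shows "2 ^ k * (real (a choose k) / real (n choose k)) \<le>
         (1 + \<rho>) ^ k * exp (- (real (k choose 2) * ((1 - \<rho>) / (1 + \<rho>)) / real n))"
proof (cases "k \<le> a")
  case True
  define r where "r = (1 - \<rho>) / (1 + \<rho>)"
  have n: "real n > 0" using assms by auto
  have \<rho>: "1 + \<rho> > 0" "\<rho> \<le> 1" "(1 + \<rho>) * r = 1 - \<rho>"
    using one_plus_bias[of n a] bias_bounds[of a n] assms n by (auto simp: r_def)
  have na: "2 * real a = real n * (1 + \<rho>)" using n by (simp add: \<rho>_def one_plus_bias)
  have "2 ^ k * (real (a choose k) / real (n choose k)) = (\<Prod>i<k. 2 * ((real a - real i) / (real n - real i)))"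
    unfolding prod.distrib using binomial_ratio_prod[OF True assms(2)] by simp
  also have "\<dots> \<le> (\<Prod>i<k. (1 + \<rho>) * exp (- (real i * r / real n)))"
  proof (rule prod_mono, rule conjI)
    fix i assume "i \<in> {..<k}"
    hence i: "real i < real a" "real i < real n" using True assms by auto
    show "0 \<le> 2 * ((real a - real i) / (real n - real i))" using i by auto
    have "2 * ((real a - real i) / (real n - real i)) = (1 + \<rho>) - real i * (1 - \<rho>) / (real n - real i)"
      using i na by (simp add: field_simps)
    also have "\<dots> \<le> (1 + \<rho>) - real i * (1 - \<rho>) / real n"
      using i \<rho> by (intro diff_left_mono divide_left_mono) auto
    also have "\<dots> = (1 + \<rho>) * (1 + (- (real i * r / real n)))"
      unfolding \<rho>(3)[symmetric] by (simp add: algebra_simps add_divide_distrib)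
    also have "\<dots> \<le> (1 + \<rho>) * exp (- (real i * r / real n))"
      using \<rho> by (intro mult_left_mono exp_ge_add_one_self) auto
    finally show "2 * ((real a - real i) / (real n - real i)) \<le> (1 + \<rho>) * exp (- (real i * r / real n))" .
  qed
  also have "\<dots> = (1 + \<rho>) ^ k * exp (\<Sum>i<k. - (real i * r / real n))"
    by (simp add: prod.distrib exp_sum)
  also have "(\<Sum>i<k. - (real i * r / real n)) = - (real (k choose 2) * r / real n)"
  proof -
    have "(\<Sum>i<k. real i) = real (k choose 2)"
      by (induction k) (simp_all add: numeral_2_eq_2)
    thus ?thesis by (simp add: sum_negf sum_divide_distrib[symmetric] sum_distrib_right[symmetric])
  qed
  finally show ?thesis by (simp add: r_def)
next
  case False
  have "1 + \<rho> \<ge> 0" using one_plus_bias[of n a] assms by auto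
  thus ?thesis using False by (simp add: binomial_eq_0)
qed

section \<open>Tail and entropy bounds for binomial coefficients\<close>

text \<open>Hoeffding's inequality for \<open>n\<close> fair coins, with the single outcome
  \<open>a\<close> placed in the tail it delimits.\<close>

lemma binomial_central_le:
  assumes "n > 0" "a \<le> n"
  shows "real (n choose a) / 2 ^ n \<le> 2 * exp (- real n * (bias n a)\<^sup>2 / 2)"
proof -
  interpret binomial_distribution n "1/2" by unfold_locales auto
  let ?e = "\<bar>bias n a\<bar> / 2"
  have "real (n choose a) / 2 ^ n = pmf (binomial_pmf n (1/2)) a"
  proof -
    have "(1/2::real) ^ a * (1/2) ^ (n - a) = (1/2) ^ n" using assms by (simp flip: power_add)
    thus ?thesis by (simp add: power_divide mult.assoc)
  qed
  also have "\<dots> = measure_pmf.prob (binomial_pmf n (1/2)) {a}" by (simp add: measure_pmf_single)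
  also have "\<dots> \<le> measure_pmf.prob (binomial_pmf n (1/2)) {x. \<bar>real x / real n - 1/2\<bar> \<ge> ?e}"
  proof (rule measure_pmf.finite_measure_mono)
    have "real a / real n - 1/2 = bias n a / 2" using assms by (simp add: bias_def field_simps)
    hence "\<bar>real a / real n - 1/2\<bar> = ?e" by (simp only: abs_divide)
    thus "{a} \<subseteq> {x. \<bar>real x / real n - 1/2\<bar> \<ge> ?e}" by simp
  qed simp
  also have "\<dots> \<le> 2 * exp (-2 * real n * ?e\<^sup>2)"
    using prob_abs_ge'[of ?e] assms by simp
  also have "-2 * real n * ?e\<^sup>2 = - real n * (bias n a)\<^sup>2 / 2" by (simp add: power_divide)
  finally show ?thesis .
qed

text \<open>Bounds the binary entropy of \<open>\<delta>\<close> from above; its value at \<open>0\<close> is \<open>0\<close>, as it should be, because \<open>ln 0 = 0\<close>.\<close>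

definition ent :: "real \<Rightarrow> real" where
  "ent \<delta> = \<delta> * (1 - ln \<delta>)"

lemma ent_mono:
  assumes "0 \<le> x" "x \<le> y" "y \<le> 1"
  shows "ent x \<le> ent y"
proof (cases "x = 0")
  case True
  have "ln y \<le> 1" using ln_le_minus_one[of y] assms by (cases "y = 0") auto
  thus ?thesis using assms True by (simp add: ent_def)
next
  case False
  hence x: "0 < x" using assms by simp
  show ?thesis
  proof (rule DERIV_nonneg_imp_nondecreasing[OF assms(2)])
    fix z assume z: "x \<le> z" "z \<le> y"
    have "(ent has_real_derivative (- ln z)) (at z)"
      unfolding ent_def using z x by (auto intro!: derivative_eq_intros)
    thus "\<exists>d. (ent has_real_derivative d) (at z) \<and> 0 \<le> d"
      using z x assms by (intro exI[of _ "- ln z"]) auto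
  qed
qed

text \<open>With \<open>\<delta> = d / n\<close>, a single term of the expansion of
  \<open>(1 + \<delta>) ^ n\<close> is at most the whole, which is at most
  \<open>exp (real d)\<close>.\<close>

lemma binomial_ent_le:
  assumes "d \<le> n" "n > 0"
  shows "real (n choose d) \<le> exp (real n * ent (real d / real n))"
proof (cases "d = 0")
  case False
  define \<delta> where "\<delta> = real d / real n"
  have \<delta>: "\<delta> > 0" "real n * \<delta> = real d" using False assms by (auto simp: \<delta>_def)
  have "real (n choose d) * \<delta> ^ d = real (n choose d) * \<delta> ^ d * 1 ^ (n - d)" by simp
  also have "\<dots> \<le> (\<Sum>j\<le>n. real (n choose j) * \<delta> ^ j * 1 ^ (n - j))"
    using \<delta> assms by (intro member_le_sum) auto
  also have "\<dots> = (\<delta> + 1) ^ n" by (rule binomial_ring[symmetric])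
  also have "\<dots> \<le> exp \<delta> ^ n" using \<delta> exp_ge_add_one_self[of \<delta>] by (intro power_mono) (auto simp: add.commute)
  also have "\<dots> = exp (real d)" using \<delta>(2) by (simp flip: exp_of_nat_mult)
  finally have "real (n choose d) \<le> exp (real d) / \<delta> ^ d" using \<delta> by (simp add: pos_le_divide_eq)
  also have "\<delta> ^ d = exp (real d * ln \<delta>)" using \<delta> by (simp add: exp_of_nat_mult)
  also have "exp (real d) / exp (real d * ln \<delta>) = exp (real n * \<delta> * (1 - ln \<delta>))"
    unfolding \<delta>(2) by (simp add: exp_diff[symmetric] algebra_simps)
  finally show ?thesis by (simp only: ent_def \<delta>_def mult.assoc)
qed (simp add: ent_def)

section \<open>The density and the requirements on \<open>k\<close>\<close>

text \<open>The relative gap \<open>1 / (8 k^2)\<close> below \<open>2^k ln 2\<close> leaves slack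
  for the second moment, yet is small against the saving \<open>1 / (2 k^2)\<close> of the
  two-choice strategy.\<close>

definition lower_density :: "nat \<Rightarrow> real" where
  "lower_density k = 2 ^ k * ln 2 * (1 - 1 / (8 * real k ^ 2))"

definition large_k :: "nat \<Rightarrow> bool" where
  "large_k k \<longleftrightarrow> 24 \<le> k \<and> ent (2 powr (- real k / 4)) \<le> ln 2 / (32 * real k ^ 2) \<and>
     num_large k > 0 \<and> 1 + real k + real (k choose 2) \<le> (num_large k)\<^sup>2 \<and>
     lower_density k * 2 ^ k / (num_large k)\<^sup>2 \<le> ln 2 * (1 - 1 / (16 * real k ^ 2))"

lemma eventually_large_k: "eventually large_k at_top"
proof -
  have c2: "real (k choose 2) = real k * (real k - 1) / 2" for k
    by (induction k) (simp_all add: numeral_2_eq_2 field_simps)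
  have N: "num_large = (\<lambda>k. 2 ^ k - 1 - real k - real k * (real k - 1) / 2)"
    by (simp add: num_large_def c2 fun_eq_iff)
  have l2: "ln (2::real) > 0" by simp
  have "\<forall>\<^sub>F k in sequentially. ent (2 powr (- real k / 4)) \<le> ln 2 / (32 * real k ^ 2)"
    unfolding ent_def by real_asymp
  moreover have "\<forall>\<^sub>F k in sequentially. num_large k > 0" unfolding N by real_asymp
  moreover have "\<forall>\<^sub>F k in sequentially. 1 + real k + real (k choose 2) \<le> (num_large k)\<^sup>2"
    unfolding N c2 by real_asymp
  moreover have "\<forall>\<^sub>F k in sequentially. 2 * ((1 + real k + real k * (real k - 1) / 2) / 2 ^ k) \<le> 1 / (16 * real k ^ 2)"
    by real_asymp
  ultimately show ?thesis using eventually_ge_at_top[of 24]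
  proof eventually_elim
    case (elim k)
    have "lower_density k * 2 ^ k / (num_large k)\<^sup>2 = ln 2 * ((1 - 1 / (8 * real k ^ 2)) * 4 ^ k / (num_large k)\<^sup>2)"
    proof -
      have "(4::real) ^ k = 2 ^ k * 2 ^ k" by (simp flip: power_mult_distrib)
      thus ?thesis by (simp add: lower_density_def)
    qed
    also have "\<dots> \<le> ln 2 * (1 - 1 / (16 * real k ^ 2))"
    proof (rule mult_left_mono)
      \<comment> \<open>The gap in the density is \<open>2 * e\<close>. As
        \<open>1 - 2 * e \<le> (1 - e)^2\<close>, one factor \<open>1 - e\<close> can pay for
        replacing \<open>4 ^ k\<close> by \<open>(num_large k)\<^sup>2\<close>, and the other
        remains.\<close>
      define e where "e = 1 / (16 * real k ^ 2)"
      define x where "x = (1 + real k + real k * (real k - 1) / 2) / 2 ^ k"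
      have N: "num_large k = 2 ^ k * (1 - x)" by (simp add: N x_def field_simps)
      have xe: "2 * x \<le> e" using elim by (simp add: x_def e_def)
      have "1 \<le> real k ^ 2" using elim by (intro one_le_power) auto
      hence e1: "e \<le> 1" by (auto simp: e_def divide_le_eq_1)
      have x1: "1 - x > 0" using elim(2) by (simp add: N zero_less_mult_iff)
      have "1 - 2 * e \<le> (1 - e) * (1 - e)" by (simp add: algebra_simps)
      also have "\<dots> \<le> (1 - e) * (1 - x)\<^sup>2"
      proof (rule mult_left_mono)
        have "1 - 2 * x \<le> (1 - x)\<^sup>2" by (simp add: power2_eq_square algebra_simps)
        thus "1 - e \<le> (1 - x)\<^sup>2" using xe by linarith
      qed (use e1 in auto)
      finally have "(1 - 2 * e) / (1 - x)\<^sup>2 \<le> 1 - e" using x1 by (simp add: divide_le_eq)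
      moreover have "(num_large k)\<^sup>2 = 4 ^ k * (1 - x)\<^sup>2"
      proof -
        have "((2::real) ^ k)\<^sup>2 = 4 ^ k" by (simp add: power2_eq_square flip: power_mult_distrib)
        thus ?thesis by (simp add: N power_mult_distrib)
      qed
      ultimately show "(1 - 1 / (8 * real k ^ 2)) * 4 ^ k / (num_large k)\<^sup>2 \<le> 1 - 1 / (16 * real k ^ 2)"
        by (simp add: e_def)
    qed (use l2 in auto)
    finally show ?case using elim by (simp add: large_k_def)
  qed
qed

lemma ln2_bounds: "ln (2::real) \<ge> 2/3" "ln (2::real) \<le> 7/10"
  using ln2_ge_two_thirds ln2_le_25_over_36 by auto

text \<open>For nearly equal assignments, with \<open>\<delta>\<close> the fraction of
  disagreements, the entropy of the number of pairs competes with the loss in correlation. The sum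
  stays below \<open>ln 2\<close> by a fixed margin.\<close>

lemma tail_exponent:
  assumes k: "large_k k" and \<delta>: "0 \<le> \<delta>" "\<delta> \<le> 1/6"
  shows "ent \<delta> + ln 2 * (1 - 1 / (16 * real k ^ 2)) * (1 - \<delta>) ^ k \<le> ln 2 - ln 2 / (32 * real k ^ 2)"
proof -
  define l where "l = ln (2::real) * (1 - 1 / (16 * real k ^ 2))"
  have k24: "real k \<ge> 24" using k by (simp add: large_k_def)
  have ksq: "real k ^ 2 \<ge> 576" using power_mono[OF k24, of 2] by simp
  have kinv: "0 < 1 / real k ^ 2" "1 / real k ^ 2 \<le> 1 / 576"
    using ksq k24 by (auto simp: field_simps)
  define z where "z = ln 2 * (1 / real k ^ 2)"
  have z: "0 \<le> z" "z \<le> ln 2 / 576"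
    using kinv mult_left_mono[OF kinv(2), of "ln 2"] by (auto simp: z_def)
  have l: "0 \<le> l" "l \<le> ln 2" "l = ln 2 - z / 16"
  proof -
    show "l = ln 2 - z / 16" by (simp add: l_def z_def algebra_simps)
    have "0 \<le> 1 - 1 / (16 * real k ^ 2)" "1 - 1 / (16 * real k ^ 2) \<le> 1"
      using kinv by auto
    thus "0 \<le> l" "l \<le> ln 2" unfolding l_def by (auto intro!: mult_left_le)
  qed
  have pe: "(1 - \<delta>) ^ k \<le> exp (- (real k * \<delta>))"
  proof -
    have "(1 - \<delta>) ^ k \<le> exp (- \<delta>) ^ k" using \<delta> exp_ge_add_one_self[of "-\<delta>"] by (intro power_mono) auto
    thus ?thesis by (simp flip: exp_of_nat_mult)
  qed
  \<comment> \<open>For large \<open>\<delta>\<close> both terms are small. In the middle range the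
    linear decay of the power beats the entropy. For tiny \<open>\<delta>\<close> the entropy lies
    below the slack in \<open>l\<close>.\<close>
  consider "\<delta> \<ge> 2 / real k" | "2 powr (- real k / 4) \<le> \<delta>" "\<delta> \<le> 2 / real k" | "\<delta> \<le> 2 powr (- real k / 4)"
    by linarith
  hence "ent \<delta> + l * (1 - \<delta>) ^ k \<le> ln 2 - z / 32"
  proof cases
    case 1
    have "ent \<delta> \<le> ent (1/6)" using \<delta> by (intro ent_mono) auto
    also have "\<dots> = (1 + ln 6) / 6" by (simp add: ent_def ln_div)
    also have "ln (6::real) \<le> 2"
    proof -
      have "(6::real) \<le> (1 + 2 / 16) ^ 16" by (simp add: power_divide)
      also have "\<dots> \<le> exp 2" using exp_ge_one_plus_x_over_n_power_n[of 16 2] by simp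
      finally show ?thesis using ln_le_cancel_iff[of 6 "exp 2"] by simp
    qed
    finally have a: "ent \<delta> \<le> 1/2" by simp
    have "(1 - \<delta>) ^ k \<le> exp (- 2)"
      using pe 1 k24 by (elim order_trans) (simp add: field_simps)
    also have "\<dots> \<le> 1/5"
    proof -
      have "(5::real) \<le> exp 2" using exp_lower_Taylor_quadratic[of "2::real"] by simp
      thus ?thesis by (simp add: exp_minus field_simps)
    qed
    finally have "l * (1 - \<delta>) ^ k \<le> ln 2 * (1/5)" using l \<delta> by (intro mult_mono) auto
    thus ?thesis using a z ln2_bounds by linarith
  next
    case 2
    have pos: "\<delta> > 0" using 2(1) by (rule less_le_trans[rotated]) simp
    have "ln (2 powr (- real k / 4)) \<le> ln \<delta>" using 2(1) pos by (subst ln_le_cancel_iff) auto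
    hence "- ln \<delta> \<le> real k / 4 * ln 2" by (simp add: ln_powr)
    hence a: "ent \<delta> \<le> \<delta> * (1 + real k / 4 * ln 2)"
      unfolding ent_def using \<delta> by (intro mult_left_mono) auto
    have y: "real k * \<delta> \<ge> 0" "real k * \<delta> \<le> 2" using 2(2) \<delta> k24 by (auto simp: field_simps)
    have "exp (- (real k * \<delta>)) \<le> 1 / (1 + real k * \<delta>)"
      using exp_ge_add_one_self[of "real k * \<delta>"] y by (simp add: exp_minus field_simps)
    also have "\<dots> \<le> 1 - real k * \<delta> / 3"
    proof -
      define u where "u = real k * \<delta>"
      have u: "0 \<le> u" "0 \<le> u * (2 - u)" using y by (auto simp: u_def intro!: mult_nonneg_nonneg)
      \<comment> \<open>The difference of the sides is \<open>u (2 - u) / 3\<close>; this is where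
        the limit \<open>2 / k\<close> on \<open>\<delta>\<close> comes from.\<close>
      hence "1 \<le> (1 - u / 3) * (1 + u)" by (simp add: algebra_simps)
      thus ?thesis using u unfolding u_def[symmetric] by (simp add: pos_divide_le_eq)
    qed
    finally have "l * (1 - \<delta>) ^ k \<le> l * (1 - real k * \<delta> / 3)"
      using pe l by (intro mult_left_mono) auto
    moreover have "\<delta> * (1 + real k / 4 * ln 2) \<le> \<delta> * (l * real k / 3)"
    proof (rule mult_left_mono)
      \<comment> \<open>This margin is the origin of the requirement
        \<open>24 \<le> k\<close>.\<close>
      have "l / 3 - ln 2 / 4 \<ge> 1 / 24" using l(3) z ln2_bounds(1) by linarith
      hence "real k * (l / 3 - ln 2 / 4) \<ge> 24 * (1 / 24)" using k24 by (intro mult_mono) auto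
      thus "1 + real k / 4 * ln 2 \<le> l * real k / 3" by (simp add: algebra_simps)
    qed (use \<delta> in auto)
    ultimately have "ent \<delta> + l * (1 - \<delta>) ^ k \<le> l" using a by (simp add: algebra_simps)
    also have "l \<le> ln 2 - z / 32" 
using l(3) z by linarith
    finally show ?thesis .
  next
    case 3
    have "ent \<delta> \<le> ent (2 powr (- real k / 4))"
    proof (intro ent_mono \<delta> 3)
      have "(2::real) powr (- real k / 4) \<le> 2 powr 0" by (intro powr_mono) auto
      thus "(2::real) powr (- real k / 4) \<le> 1" by simp
    qed
    also have "\<dots> \<le> z / 32" using k by (simp add: large_k_def z_def)
    finally have "ent \<delta> \<le> z / 32" .
    moreover have "l * (1 - \<delta>) ^ k \<le> l" using l \<delta> by (intro mult_left_le power_le_one) auto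
    ultimately show ?thesis using l(3) by linarith
  qed
  thus ?thesis by (simp add: l_def z_def)
qed

section \<open>Contributions of large overlaps\<close>

lemma power_le_exp_mult:
  fixes g :: real
  assumes "-1 \<le> g" "g \<le> B" "0 \<le> B" "real m \<le> M"
  shows "(1 + g) ^ m \<le> exp (M * B)"
proof -
  have "(1 + g) ^ m \<le> exp B ^ m"
    using assms exp_ge_add_one_self[of B] by (intro power_mono) linarith+
  also have "\<dots> = exp (real m * B)" by (simp add: exp_of_nat_mult)
  also have "\<dots> \<le> exp (M * B)" using assms by (simp add: mult_right_mono)
  finally show ?thesis .
qed

lemma lower_density_pos:
  assumes "k \<ge> 1"
  shows "lower_density k > 0"
proof -
  have "real k ^ 2 \<ge> 1" using assms by (intro one_le_power) auto
  hence "1 / (8 * real k ^ 2) < 1" by (auto simp: divide_less_eq_1)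
  thus ?thesis by (simp add: lower_density_def)
qed

text \<open>The cubic bound on \<open>taylor3\<close> yields the exponent
  \<open>(\<alpha> / num_large k) n \<rho>^3\<close>. With 7/10 it stays below the Gaussian exponent
  \<open>n \<rho>^2 / 2\<close> up to \<rho> = 2/3.\<close>

lemma lower_density_over_num_large:
  assumes "large_k k"
  shows "lower_density k / num_large k \<le> 7/10"
proof -
  have N: "num_large k > 0" "num_large k \<le> 2 ^ k" using assms by (auto simp: large_k_def num_large_def)
  have \<alpha>: "lower_density k > 0" using assms by (intro lower_density_pos) (auto simp: large_k_def)
  have "lower_density k / num_large k = lower_density k * num_large k / (num_large k)\<^sup>2"
    using N by (simp add: power2_eq_square)
  also have "\<dots> \<le> lower_density k * 2 ^ k / (num_large k)\<^sup>2"
    using N \<alpha> by (intro divide_right_mono mult_left_mono) auto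
  also have "\<dots> \<le> ln 2 * (1 - 1 / (16 * real k ^ 2))" using assms by (simp add: large_k_def)
  also have "\<dots> \<le> ln 2 * 1" by (intro mult_left_mono) auto
  also have "\<dots> \<le> 7/10" using ln2_bounds by simp
  finally show ?thesis .
qed

lemma outer_term_le:
  assumes k: "large_k k" and n: "k \<le> n" and a: "a \<le> n" and m: "real m \<le> lower_density k * real n"
    and out: "\<bar>bias n a\<bar> \<ge> real n powr (- 2/5)"
  shows "real (n choose a) / 2 ^ n * (1 + overlap_term n k a / (num_large k)\<^sup>2) ^ m \<le>
         2 * exp (2 * lower_density k * real (k choose 2) / (num_large k)\<^sup>2
           - ln 2 / (32 * real k ^ 2) * real n powr (1/5))"
proof -
  define \<rho> where "\<rho> = bias n a"
  define \<alpha> where "\<alpha> = lower_density k"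
  define N where "N = num_large k"
  define C where "C = real (k choose 2)"
  define g where "g = overlap_term n k a / N\<^sup>2"
  define c where "c = ln (2::real) / (32 * real k ^ 2)"
  have k24: "k \<ge> 24" and N0: "N > 0" using k by (auto simp: large_k_def N_def)
  have n2: "n \<ge> 2" "n > 0" using n k24 by auto
  have \<alpha>0: "\<alpha> > 0" unfolding \<alpha>_def using k24 by (intro lower_density_pos) auto
  have C0: "C \<ge> 0" by (simp add: C_def)
  have \<rho>: "-1 \<le> \<rho>" "\<rho> \<le> 1" using bias_bounds[OF a n2(2)] by (auto simp: \<rho>_def)
  have g: "g \<ge> -1"
  proof -
    have "- (N\<^sup>2) \<le> overlap_term n k a"
      using overlap_term_ge[OF n2(1) a, of k] k by (simp add: large_k_def N_def)
    thus ?thesis using N0 by (simp add: g_def pos_le_divide_eq)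
  qed
  \<comment> \<open>The \<open>1/n\<close> part of the overlap term contributes only a bounded
    factor to the power.\<close>
  have E: "\<alpha> * real n * (C / (real n - 1) / N\<^sup>2) \<le> 2 * \<alpha> * C / N\<^sup>2"
  proof -
    have "real n / (real n - 1) \<le> 2" using n2 by (simp add: divide_le_eq)
    hence "\<alpha> * C / N\<^sup>2 * (real n / (real n - 1)) \<le> \<alpha> * C / N\<^sup>2 * 2"
      using \<alpha>0 C0 N0 by (intro mult_left_mono) auto
    thus ?thesis by (simp add: mult_ac)
  qed
  have ole: "overlap_term n k a \<le> taylor3 k \<rho> + C / (real n - 1)"
    using overlap_term_le[OF n2(1) n a] by (simp add: \<rho>_def C_def)
  have key: "(1 + g) ^ m \<le> exp (\<alpha> * real n * (T / N\<^sup>2) + 2 * \<alpha> * C / N\<^sup>2)"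
    if T: "taylor3 k \<rho> \<le> T" "T \<ge> 0" for T
  proof -
    have "(1 + g) ^ m \<le> exp (\<alpha> * real n * ((T + C / (real n - 1)) / N\<^sup>2))"
    proof (rule power_le_exp_mult[OF g])
      show "g \<le> (T + C / (real n - 1)) / N\<^sup>2"
        unfolding g_def using ole T by (intro divide_right_mono) auto
    qed (use T C0 n2 m in \<open>auto simp: \<alpha>_def\<close>)
    also have "\<dots> \<le> exp (\<alpha> * real n * (T / N\<^sup>2) + 2 * \<alpha> * C / N\<^sup>2)"
      using E by (simp add: add_divide_distrib distrib_left)
    finally show ?thesis .
  qed
  have c: "0 \<le> c" "c \<le> 1/30"
  proof -
    have "real k ^ 2 \<ge> 24 ^ 2" using k24 by (intro power_mono) auto
    hence "ln 2 / (32 * real k ^ 2) \<le> (7/10) / (32 * 24 ^ 2)" using ln2_bounds by (intro frac_le) auto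
    thus "c \<le> 1/30" by (simp add: c_def)
  qed (simp add: c_def)
  have np: "real n powr (1/5) \<le> real n * \<rho>\<^sup>2" "real n powr (1/5) \<le> real n" "real n powr (1/5) \<ge> 0"
  proof -
    have "(real n powr (- 2/5))\<^sup>2 \<le> \<bar>\<rho>\<bar>\<^sup>2" using out by (intro power_mono) (auto simp: \<rho>_def)
    hence "real n * (real n powr (- 2/5))\<^sup>2 \<le> real n * \<rho>\<^sup>2" by (intro mult_left_mono) auto
    moreover have "real n * (real n powr (- 2/5))\<^sup>2 = real n powr (1/5)"
    proof -
      have "real n * (real n powr (- 2/5))\<^sup>2 = real n powr 1 * real n powr (- 4/5)"
        using n2 by (simp add: power2_eq_square flip: powr_add)
      also have "\<dots> = real n powr (1/5)" by (simp only: powr_add[symmetric]) simp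
      finally show ?thesis .
    qed
    ultimately show "real n powr (1/5) \<le> real n * \<rho>\<^sup>2" by simp
    have "real n powr (1/5) \<le> real n powr 1" using n2 by (intro powr_mono) auto
    thus "real n powr (1/5) \<le> real n" using n2 by simp
  qed auto
  have cen: "real (n choose a) / 2 ^ n \<le> 2 * exp (- real n * \<rho>\<^sup>2 / 2)"
    using binomial_central_le[OF n2(2) a] by (simp add: \<rho>_def)
  \<comment> \<open>Up to 2/3 the Gaussian bound wins, with margin 1/2 - 7/15 = 1/30. Beyond it the
    disagreement fraction is below 1/6 and the entropy bound takes over.\<close>
  have "real (n choose a) / 2 ^ n * (1 + g) ^ m \<le> 2 * exp (2 * \<alpha> * C / N\<^sup>2 - c * real n powr (1/5))"
  proof (cases "\<rho> \<le> 2/3")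
    case True
    have "\<exists>T. taylor3 k \<rho> \<le> T \<and> 0 \<le> T \<and> \<alpha> * real n * (T / N\<^sup>2) \<le> 7/15 * (real n * \<rho>\<^sup>2)"
    proof (cases "\<rho> \<le> 0")
      case True
      thus ?thesis using taylor3_nonpos[OF \<rho>(1) True, of k] by (intro exI[of _ 0]) auto
    next
      case False
      have "\<alpha> * real n * (N * \<rho> ^ 3 / N\<^sup>2) = (\<alpha> / N) * (real n * \<rho>\<^sup>2) * \<rho>"
        using N0 by (simp add: power2_eq_square power3_eq_cube)
      also have "\<dots> \<le> (7/10) * (real n * \<rho>\<^sup>2) * (2/3)"
        using lower_density_over_num_large[OF k] True False by (intro mult_mono) (auto simp: \<alpha>_def N_def)
      finally have "\<alpha> * real n * (N * \<rho> ^ 3 / N\<^sup>2) \<le> 7/15 * (real n * \<rho>\<^sup>2)" by simp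
      moreover have "taylor3 k \<rho> \<le> N * \<rho> ^ 3" using abs_taylor3_le[of \<rho> k] \<rho> False by (simp add: N_def)
      ultimately show ?thesis using False N0 by (intro exI[of _ "N * \<rho> ^ 3"]) auto
    qed
    then obtain T where T: "taylor3 k \<rho> \<le> T" "0 \<le> T" "\<alpha> * real n * (T / N\<^sup>2) \<le> 7/15 * (real n * \<rho>\<^sup>2)"
      by blast
    have "real (n choose a) / 2 ^ n * (1 + g) ^ m \<le>
          2 * exp (- real n * \<rho>\<^sup>2 / 2) * exp (7/15 * (real n * \<rho>\<^sup>2) + 2 * \<alpha> * C / N\<^sup>2)"
    proof (rule mult_mono[OF cen])
      show "(1 + g) ^ m \<le> exp (7/15 * (real n * \<rho>\<^sup>2) + 2 * \<alpha> * C / N\<^sup>2)"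
        by (rule order_trans[OF key[OF T(1,2)]]) (use T(3) in simp)
    qed (use g in auto)
    also have "\<dots> = 2 * exp (2 * \<alpha> * C / N\<^sup>2 - 1/30 * (real n * \<rho>\<^sup>2))"
      by (simp add: exp_add[symmetric] algebra_simps)
    also have "\<dots> \<le> 2 * exp (2 * \<alpha> * C / N\<^sup>2 - c * real n powr (1/5))"
    proof -
      have "c * real n powr (1/5) \<le> 1/30 * (real n * \<rho>\<^sup>2)" using c np by (intro mult_mono) auto
      thus ?thesis by simp
    qed
    finally show ?thesis .
  next
    case False
    define \<delta> where "\<delta> = real (n - a) / real n"
    have \<rho>\<delta>: "1 + \<rho> = 2 * (1 - \<delta>)"
      using one_plus_bias[OF n2(2), of a] n2 a by (simp add: \<rho>_def \<delta>_def of_nat_diff field_simps)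
    have \<delta>: "0 \<le> \<delta>" "\<delta> \<le> 1/6" 
    proof -
      show "0 \<le> \<delta>" by (simp add: \<delta>_def)
      show "\<delta> \<le> 1/6" using False \<rho>\<delta> by (simp add: not_le)
    qed
    have "real (n choose a) = real (n choose (n - a))" using a by (simp add: binomial_symmetric[of a n])
    also have "\<dots> \<le> exp (real n * ent \<delta>)" unfolding \<delta>_def by (rule binomial_ent_le) (use n2 in auto)
    finally have "real (n choose a) / 2 ^ n \<le> exp (real n * ent \<delta>) / 2 ^ n" by (intro divide_right_mono) auto
    also have "exp (real n * ent \<delta>) / 2 ^ n = exp (real n * (ent \<delta> - ln 2))"
    proof -
      have "(2::real) ^ n = exp (real n * ln 2)" by (simp add: exp_of_nat_mult)
      thus ?thesis by (simp add: exp_diff[symmetric] algebra_simps)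
    qed
    finally have bin: "real (n choose a) / 2 ^ n \<le> exp (real n * (ent \<delta> - ln 2))" .
    have T: "taylor3 k \<rho> \<le> (1 + \<rho>) ^ k" "(1 + \<rho>) ^ k \<ge> 0"
    proof -
      have "0 \<le> real k * \<rho>" "0 \<le> real (k choose 2) * \<rho>\<^sup>2" using False by auto
      thus "taylor3 k \<rho> \<le> (1 + \<rho>) ^ k" unfolding taylor3_def by linarith
    qed (use False in auto)
    have "\<alpha> * real n * ((1 + \<rho>) ^ k / N\<^sup>2) = real n * ((\<alpha> * 2 ^ k / N\<^sup>2) * (1 - \<delta>) ^ k)"
      unfolding \<rho>\<delta> power_mult_distrib by simp
    also have "\<dots> \<le> real n * (ln 2 * (1 - 1 / (16 * real k ^ 2)) * (1 - \<delta>) ^ k)"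
      using k \<delta> by (intro mult_left_mono mult_right_mono) (auto simp: large_k_def \<alpha>_def N_def)
    finally have "(1 + g) ^ m \<le> exp (real n * (ln 2 * (1 - 1 / (16 * real k ^ 2)) * (1 - \<delta>) ^ k) + 2 * \<alpha> * C / N\<^sup>2)"
      by (intro order_trans[OF key[OF T]]) simp
    hence "real (n choose a) / 2 ^ n * (1 + g) ^ m \<le> exp (real n * (ent \<delta> - ln 2)) *
         exp (real n * (ln 2 * (1 - 1 / (16 * real k ^ 2)) * (1 - \<delta>) ^ k) + 2 * \<alpha> * C / N\<^sup>2)"
      using g by (intro mult_mono bin) auto
    also have "\<dots> = exp (2 * \<alpha> * C / N\<^sup>2 +
         real n * (ent \<delta> + ln 2 * (1 - 1 / (16 * real k ^ 2)) * (1 - \<delta>) ^ k - ln 2))"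
      by (simp add: exp_add[symmetric] distrib_left right_diff_distrib)
    also have "\<dots> \<le> exp (2 * \<alpha> * C / N\<^sup>2 - c * real n powr (1/5))"
    proof -
      have "real n * (ent \<delta> + ln 2 * (1 - 1 / (16 * real k ^ 2)) * (1 - \<delta>) ^ k - ln 2) \<le> real n * (- c)"
        using tail_exponent[OF k \<delta>] by (intro mult_left_mono) (auto simp: c_def)
      also have "\<dots> \<le> - (c * real n powr (1/5))"
        using mult_left_mono[OF np(2) c(1)] by (simp add: mult.commute)
      finally show ?thesis by simp
    qed
    also have "\<dots> \<le> 2 * \<dots>" by simp
    finally show ?thesis .
  qed
  thus ?thesis by (simp add: g_def c_def \<alpha>_def N_def C_def)
qed

section \<open>The central range and the limit of the second moment\<close>

text \<open>Bounds each part of \<open>n\<close> times the overlap term by its worst case over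
  overlaps in \<open>[-y, y]\<close>, giving one bound for the whole central range.\<close>

definition central_bound :: "nat \<Rightarrow> real \<Rightarrow> real \<Rightarrow> real" where
  "central_bound k n y = num_large k * n * y ^ 3 + real (k choose 2) * (n / (n - 1))
     - real (k choose 2) * (1 - y) ^ k / (1 + real (k choose 2) * ((1 + y) / (1 - y)) / n)"

text \<open>
  The correction of order \<open>1/n\<close> from drawing distinct variables cancels against the one from the
  terms of degree two, so that \<open>n\<close> times the overlap term tends to \<open>0\<close> in the central range.
\<close>

lemma overlap_term_central:
  assumes n: "n \<ge> 2" and a: "a \<le> n" and k: "k \<ge> 1" and y: "0 \<le> y" "y < 1" "\<bar>bias n a\<bar> \<le> y"
  shows "real n * overlap_term n k a \<le> central_bound k (real n) y"
proof -
  define \<rho> where "\<rho> = bias n a"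
  define C where "C = real (k choose 2)"
  define r where "r = (1 - \<rho>) / (1 + \<rho>)"
  define x where "x = C * r / real n"
  define z where "z = C * ((1 + y) / (1 - y)) / real n"
  have n0: "real n > 0" "real n - 1 > 0" using n by auto
  have \<rho>: "- y \<le> \<rho>" "\<rho> \<le> y" "1 + \<rho> > 0" "1 - \<rho> > 0" using y by (auto simp: \<rho>_def)
  have a0: "a > 0"
  proof (rule ccontr)
    assume "\<not> a > 0"
    thus False using y n0 by (simp add: bias_def)
  qed
  have C0: "C \<ge> 0" by (simp add: C_def)
  have r0: "r \<ge> 0" using \<rho> by (simp add: r_def)
  have "r \<le> (1 + y) / (1 - y)" unfolding r_def using \<rho> y by (intro frac_le) auto
  hence "x \<le> z" unfolding x_def z_def using C0 n0 by (intro divide_right_mono mult_left_mono) auto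
  moreover have "0 \<le> x" unfolding x_def using C0 r0 n0 by auto
  ultimately have xz: "0 \<le> x" "x \<le> z" by auto
  \<comment> \<open>A rational upper bound on the exponential keeps the gain
    \<open>x / (1 + x)\<close> explicit.\<close>
  have "exp (- x) \<le> 1 / (1 + x)" using xz exp_ge_add_one_self[of x] by (simp add: exp_minus field_simps)
  also have "\<dots> = 1 - x / (1 + x)" using xz by (simp add: field_simps)
  finally have e: "exp (- x) \<le> 1 - x / (1 + x)" .
  have "2 ^ k * (real (a choose k) / real (n choose k)) \<le> (1 + \<rho>) ^ k * exp (- x)"
    using binomial_ratio_exp_le[OF a0 a, of k] by (simp add: \<rho>_def x_def r_def C_def)
  also have "\<dots> \<le> (1 + \<rho>) ^ k * (1 - x / (1 + x))" using \<rho> e by (intro mult_left_mono) auto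
  finally have 1: "2 ^ k * (real (a choose k) / real (n choose k)) - (1 + \<rho>) ^ k \<le> - ((1 + \<rho>) ^ k * (x / (1 + x)))"
    by (simp add: algebra_simps)
  \<comment> \<open>The denominator of \<open>r\<close> cancels one factor
    \<open>1 + \<rho>\<close>, leaving \<open>k\<close> factors that are each at least
    \<open>1 - y\<close>.\<close>
  have "(1 - y) ^ k \<le> (1 + \<rho>) ^ k * r"
  proof -
    have "(1 - y) ^ k = (1 - y) ^ (k - 1) * (1 - y)" using k by (cases k) auto
    also have "\<dots> \<le> (1 + \<rho>) ^ (k - 1) * (1 - \<rho>)" using \<rho> y by (intro mult_mono power_mono) auto
    also have "\<dots> = (1 + \<rho>) ^ k * r" using k \<rho> by (cases k) (auto simp: r_def)
    finally show ?thesis .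
  qed
  hence "C * (1 - y) ^ k / (1 + z) \<le> C * ((1 + \<rho>) ^ k * r) / (1 + x)"
    using C0 xz r0 \<rho> by (intro frac_le mult_left_mono) auto
  also have "\<dots> = real n * ((1 + \<rho>) ^ k * (x / (1 + x)))" using n0 by (simp add: x_def)
  finally have 2: "C * (1 - y) ^ k / (1 + z) \<le> real n * ((1 + \<rho>) ^ k * (x / (1 + x)))" .
  have "taylor3 k \<rho> \<le> num_large k * \<bar>\<rho>\<bar> ^ 3"
  proof -
    have "\<bar>\<rho>\<bar> \<le> 1" using \<rho> y by linarith
    thus ?thesis using abs_taylor3_le[of \<rho> k] by linarith
  qed
  also have "\<dots> \<le> num_large k * y ^ 3"
    using num_large_nonneg[of k] \<rho> by (intro mult_left_mono power_mono) auto
  finally have 3: "real n * taylor3 k \<rho> \<le> real n * (num_large k * y ^ 3)" by (intro mult_left_mono) auto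
  have "C * (1 - \<rho>\<^sup>2) / (real n - 1) \<le> C * 1 / (real n - 1)"
    using C0 n0 by (intro divide_right_mono mult_left_mono) auto
  hence 4: "real n * (C * (1 - \<rho>\<^sup>2) / (real n - 1)) \<le> real n * (C * 1 / (real n - 1))" by (intro mult_left_mono) auto
  have "real n * overlap_term n k a = real n * (2 ^ k * (real (a choose k) / real (n choose k)) - (1 + \<rho>) ^ k)
      + real n * taylor3 k \<rho> + real n * (C * (1 - \<rho>\<^sup>2) / (real n - 1))"
    unfolding overlap_term_bias[OF n] \<rho>_def C_def by (simp only: distrib_left)
  also have "real n * (2 ^ k * (real (a choose k) / real (n choose k)) - (1 + \<rho>) ^ k) \<le>
      real n * (- ((1 + \<rho>) ^ k * (x / (1 + x))))" using 1 by (intro mult_left_mono) auto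
  finally show ?thesis using 2 3 4
    unfolding central_bound_def C_def[symmetric] z_def[symmetric] by (simp add: mult_ac)
qed

text \<open>The cutoff \<open>y = n^(-2/5)\<close> makes \<open>n y^3 = n^(-1/5)\<close> vanish
  while \<open>n y^2 = n^(1/5)\<close> still grows, as \<open>outer_term_le\<close>
  exploits.\<close>

lemma central_bound_tendsto:
  "(\<lambda>n. central_bound k (real n) (real n powr (- 2/5))) \<longlonglongrightarrow> 0"
proof -
  have "(\<lambda>n. num_large k * (real n * (real n powr (- 2/5)) ^ 3) + real (k choose 2) * (real n / (real n - 1))
     - real (k choose 2) * (1 - real n powr (- 2/5)) ^ k /
        (1 + real (k choose 2) * ((1 + real n powr (- 2/5)) / (1 - real n powr (- 2/5)) / real n)))
     \<longlonglongrightarrow> num_large k * 0 + real (k choose 2) * 1 - real (k choose 2) * (1 - 0) ^ k / (1 + real (k choose 2) * 0)"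
  proof (intro tendsto_intros)
    show "(\<lambda>n. real n * (real n powr (- 2/5)) ^ 3) \<longlonglongrightarrow> 0" by real_asymp
    show "(\<lambda>n. real n / (real n - 1)) \<longlonglongrightarrow> 1" by real_asymp
    show "(\<lambda>n. real n powr (- 2/5)) \<longlonglongrightarrow> 0" by real_asymp
    show "(\<lambda>n. (1 + real n powr (- 2/5)) / (1 - real n powr (- 2/5)) / real n) \<longlonglongrightarrow> 0" by real_asymp
  qed auto
  thus ?thesis by (simp add: central_bound_def mult.assoc)
qed

text \<open>Central overlaps multiply the binomial weights, of total mass one, by a common factor
  tending to one. The outer ones are at most \<open>n + 1\<close> terms, each at most a constant
  times \<open>exp (- c n^(1/5))\<close> with \<open>c > 0\<close>.\<close>

lemma second_moment_ratio_le:
  assumes k: "large_k k" and n: "k \<le> n" and m: "real m \<le> lower_density k * real n"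
  shows "second_moment_ratio n k m \<le>
     exp (lower_density k * \<bar>central_bound k (real n) (real n powr (- 2/5))\<bar> / (num_large k)\<^sup>2) +
     (real n + 1) * (2 * exp (2 * lower_density k * real (k choose 2) / (num_large k)\<^sup>2
           - ln 2 / (32 * real k ^ 2) * real n powr (1/5)))"
proof -
  define y where "y = real n powr (- 2/5)"
  define \<alpha> where "\<alpha> = lower_density k"
  define N where "N = num_large k"
  define U where "U = \<bar>central_bound k (real n) y\<bar>"
  define E where "E = 2 * exp (2 * lower_density k * real (k choose 2) / (num_large k)\<^sup>2
           - ln 2 / (32 * real k ^ 2) * real n powr (1/5))"
  have k24: "k \<ge> 24" and N0: "N > 0" using k by (auto simp: large_k_def N_def)
  have n2: "n \<ge> 2" "n > 0" using n k24 by auto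
  have y: "0 \<le> y" "y < 1"
  proof -
    have "y < real n powr 0" unfolding y_def using n2 by (intro powr_less_mono) auto
    thus "y < 1" using n2 by simp
  qed (simp add: y_def)
  have "real (n choose a) / 2 ^ n * (1 + overlap_term n k a / N\<^sup>2) ^ m \<le>
        real (n choose a) / 2 ^ n * exp (\<alpha> * U / N\<^sup>2) + E" if a: "a \<le> n" for a
  proof (cases "\<bar>bias n a\<bar> \<ge> y")
    case True
    have "real (n choose a) / 2 ^ n * (1 + overlap_term n k a / N\<^sup>2) ^ m \<le> E"
      unfolding N_def E_def using True by (intro outer_term_le k n a m) (simp add: y_def)
    also have "\<dots> \<le> real (n choose a) / 2 ^ n * exp (\<alpha> * U / N\<^sup>2) + E" by simp
    finally show ?thesis .
  next
    case False
    have "real n * overlap_term n k a \<le> U"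
      using overlap_term_central[OF n2(1) a _ y, of k] False k24 by (auto simp: U_def)
    hence "overlap_term n k a / N\<^sup>2 \<le> U / real n / N\<^sup>2"
      using n2 by (intro divide_right_mono) (auto simp: field_simps)
    moreover have "- 1 \<le> overlap_term n k a / N\<^sup>2"
    proof -
      have "- (N\<^sup>2) \<le> overlap_term n k a"
        using overlap_term_ge[OF n2(1) a, of k] k by (simp add: large_k_def N_def)
      thus ?thesis using N0 by (simp add: pos_le_divide_eq)
    qed
    ultimately have "(1 + overlap_term n k a / N\<^sup>2) ^ m \<le> exp (\<alpha> * real n * (U / real n / N\<^sup>2))"
      using m by (intro power_le_exp_mult) (auto simp: U_def \<alpha>_def)
    also have "\<alpha> * real n * (U / real n / N\<^sup>2) = \<alpha> * U / N\<^sup>2" using n2 by simp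
    finally have "real (n choose a) / 2 ^ n * (1 + overlap_term n k a / N\<^sup>2) ^ m \<le>
        real (n choose a) / 2 ^ n * exp (\<alpha> * U / N\<^sup>2)" by (intro mult_left_mono) auto
    also have "\<dots> \<le> real (n choose a) / 2 ^ n * exp (\<alpha> * U / N\<^sup>2) + E" by (simp add: E_def)
    finally show ?thesis .
  qed
  hence "second_moment_ratio n k m \<le> (\<Sum>a\<le>n. real (n choose a) / 2 ^ n * exp (\<alpha> * U / N\<^sup>2) + E)"
    unfolding second_moment_ratio_def N_def[symmetric] by (intro sum_mono) auto
  also have "\<dots> = (\<Sum>a\<le>n. real (n choose a)) / 2 ^ n * exp (\<alpha> * U / N\<^sup>2) + (real n + 1) * E"
    by (simp add: sum.distrib sum_distrib_right sum_divide_distrib)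
  also have "(\<Sum>a\<le>n. real (n choose a)) = 2 ^ n"
    using choose_row_sum[of n] by (metis of_nat_numeral of_nat_power of_nat_sum)
  finally show ?thesis by (simp add: E_def U_def y_def \<alpha>_def N_def)
qed

lemma random_sat_whp:
  assumes k: "large_k k"
  shows "(\<lambda>n. measure_pmf.prob (random_formula k n (nat \<lfloor>lower_density k * real n\<rfloor>)) {F. satisfiable F}) \<longlonglongrightarrow> 1"
proof (rule tendsto_sandwich[where h = "\<lambda>_. 1"])
  let ?R = "\<lambda>n. exp (lower_density k * \<bar>central_bound k (real n) (real n powr (- 2/5))\<bar> / (num_large k)\<^sup>2) +
     (real n + 1) * (2 * exp (2 * lower_density k * real (k choose 2) / (num_large k)\<^sup>2
           - ln 2 / (32 * real k ^ 2) * real n powr (1/5)))"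
  have k24: "k \<ge> 24" and N0: "num_large k > 0" using k by (auto simp: large_k_def)
  show "\<forall>\<^sub>F n in sequentially. 2 - ?R n \<le>
    measure_pmf.prob (random_formula k n (nat \<lfloor>lower_density k * real n\<rfloor>)) {F. satisfiable F}"
    using eventually_ge_at_top[of k]
  proof eventually_elim
    case (elim n)
    have "lower_density k > 0" using k24 by (intro lower_density_pos) auto
    hence m: "real (nat \<lfloor>lower_density k * real n\<rfloor>) \<le> lower_density k * real n"
      by (intro of_nat_floor) auto
    have "2 - second_moment_ratio n k (nat \<lfloor>lower_density k * real n\<rfloor>) \<le>
       measure_pmf.prob (random_formula k n (nat \<lfloor>lower_density k * real n\<rfloor>)) {F. satisfiable F}"
      using elim k24 N0 by (intro prob_random_satisfiable_ge) auto
    thus ?case using second_moment_ratio_le[OF k elim m] by linarith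
  qed
  define c where "c = ln (2::real) / (32 * real k ^ 2)"
  define c0 where "c0 = 2 * lower_density k * real (k choose 2) / (num_large k)\<^sup>2"
  have "c > 0" using k24 by (simp add: c_def)
  hence "(\<lambda>n. (real n + 1) * (2 * exp (c0 - c * real n powr (1/5)))) \<longlonglongrightarrow> 0" by real_asymp
  hence "(\<lambda>n. 2 - ?R n) \<longlonglongrightarrow> 2 - (exp (lower_density k * \<bar>0\<bar> / (num_large k)\<^sup>2) + 0)"
    unfolding c_def c0_def using N0
    by (intro tendsto_diff tendsto_add tendsto_const tendsto_exp tendsto_divide tendsto_mult tendsto_rabs
        central_bound_tendsto) auto
  thus "(\<lambda>n. 2 - ?R n) \<longlonglongrightarrow> 1" by simp
qed (auto intro: always_eventually)

text \<open>Dropping \<open>\<beta> n\<close> variables saves a fraction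
  \<open>\<beta> = 1 / (2 k^2)\<close> in the union bound. Both offered clauses miss the inside with
  probability only about \<open>(k \<beta>)^2 = 1 / (4 k^2)\<close>.\<close>

lemma threshold_lowerable_two_choices:
  assumes k: "large_k k"
  shows "threshold_lowerable k 2"
proof -
  define \<beta> :: real where "\<beta> = 1 / (2 * real k ^ 2)"
  \<comment> \<open>This is \<open>1 - 11/10 k \<beta>\<close>; the factor 11/10 absorbs the
    \<open>real k\<close> subtracted in \<open>binomial_ratio_ge\<close>.\<close>
  define q0 where "q0 = 1 - 11 / (20 * real k)"
  define N where "N = (\<lambda>n. n - nat \<lfloor>\<beta> * real n\<rfloor>)"
  have k24: "real k \<ge> 24" using k by (simp add: large_k_def)
  have \<beta>: "0 < \<beta>" "\<beta> < 1/2"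
  proof -
    have "real k ^ 2 > 1" using k24 by (intro one_less_power) auto
    thus "0 < \<beta>" "\<beta> < 1/2" using k24 by (auto simp: \<beta>_def divide_less_eq)
  qed
  have N1: "real (N n) \<ge> (1 - \<beta>) * real n" "real (N n) \<le> (1 - \<beta>) * real n + 1" "N n \<le> n" for n
  proof -
    have "\<beta> * real n \<le> 1 * real n" using \<beta> by (intro mult_right_mono) auto
    hence "nat \<lfloor>\<beta> * real n\<rfloor> \<le> n" by linarith
    hence "real (N n) = real n - real (nat \<lfloor>\<beta> * real n\<rfloor>)" by (simp add: N_def of_nat_diff)
    moreover have "real (nat \<lfloor>\<beta> * real n\<rfloor>) \<le> \<beta> * real n" "real (nat \<lfloor>\<beta> * real n\<rfloor>) \<ge> \<beta> * real n - 1"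
      using \<beta> by (auto intro!: of_nat_floor)
    ultimately show "real (N n) \<ge> (1 - \<beta>) * real n" "real (N n) \<le> (1 - \<beta>) * real n + 1"
      by (auto simp: algebra_simps)
  qed (simp add: N_def)
  have "(\<lambda>n. measure_pmf.prob (achlioptas_formula 2 k n (\<lambda>_. choose_inside (N n)) (nat \<lfloor>lower_density k * real n\<rfloor>))
               {F. \<not> satisfiable F}) \<longlonglongrightarrow> 1"
  proof (rule achlioptas_unsat_whp[where qmin = q0 and \<epsilon> = "1 - \<beta>"])
    show "lower_density k > 0" using k24 by (intro lower_density_pos) auto
    show "q0 \<le> 1" using k24 by (simp add: q0_def)
    have "\<forall>\<^sub>F n in sequentially. real k \<le> \<beta> / 10 * real n" using \<beta> by real_asymp
    hence ev: "\<forall>\<^sub>F n in sequentially. real k \<le> \<beta> / 10 * real n \<and> n > 0"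
      using eventually_gt_at_top[of 0] by eventually_elim auto
    thus kN: "\<forall>\<^sub>F n in sequentially. k \<le> N n"
    proof eventually_elim
      case (elim n)
      have "\<beta> / 10 * real n \<le> (1 - \<beta>) * real n" using \<beta> by (intro mult_right_mono) auto
      thus ?case using N1(1)[of n] elim by linarith
    qed
    show "\<forall>\<^sub>F n in sequentially. q0 \<le> real (N n choose k) / real (n choose k)"
      using kN ev
    proof eventually_elim
      case (elim n)
      have "1 + (- (11/10 * \<beta>)) \<le> (real (N n) - real k) / real n"
        using N1(1)[of n] elim by (simp add: field_simps)
      have "q0 = 1 + real k * (- (11/10 * \<beta>))"
        using k24 by (simp add: q0_def \<beta>_def power2_eq_square)
      also have "\<dots> \<le> (1 + (- (11/10 * \<beta>))) ^ k" by (rule Bernoulli_inequality) (use \<beta> in auto)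
      also have "\<dots> \<le> ((real (N n) - real k) / real n) ^ k"
        by (rule power_mono) (use \<beta> \<open>1 + (- (11/10 * \<beta>)) \<le> (real (N n) - real k) / real n\<close> in auto)
      also have "\<dots> \<le> real (N n choose k) / real (n choose k)"
        using elim N1(3) by (intro binomial_ratio_ge) auto
      finally show ?case .
    qed
    define e where "e = 1 / real k ^ 2"
    have e: "0 < e" using k24 by (simp add: e_def)
    have "(1 - q0) ^ 2 = 121/400 * e" by (simp add: q0_def e_def power_divide power_mult_distrib)
    hence "lower_density k * (1 - (1 - q0) ^ 2) / 2 ^ k = ln 2 * ((1 - e / 8) * (1 - 121/400 * e))"
      by (simp add: lower_density_def e_def)
    \<comment> \<open>The losses 1/8 and 121/400 add up to 171/400, less than the saving 1/2, all in
      units of \<open>1 / k^2\<close>.\<close>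
    moreover have "(1 - e / 8) * (1 - 121/400 * e) > 1 - \<beta>"
    proof -
      have "\<beta> = e / 2" by (simp add: \<beta>_def e_def)
      moreover have "(1 - e / 8) * (1 - 121/400 * e) = 1 - 171/400 * e + 121/3200 * (e * e)"
        by (simp add: field_simps)
      moreover have "e * e > 0" using e by simp
      ultimately show ?thesis using e by linarith
    qed
    ultimately show "(1 - \<beta>) * ln 2 < lower_density k * (1 - (1 - q0) ^ 2) / 2 ^ k"
      by (simp add: mult.commute)
  qed (use N1 in auto)
  thus ?thesis
    unfolding threshold_lowerable_def
    using random_sat_whp[OF k] is_strategy_choose_inside[of 2] lower_density_pos[of k] k24
    by (intro exI[of _ "lower_density k"] exI[of _ "\<lambda>n _. choose_inside (N n)"]) auto
qed

theorem theorem6: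
  "(\<forall>k\<ge>2. \<exists>t. threshold_lowerable k t) \<and> (\<exists>k0. \<forall>k\<ge>k0. threshold_lowerable k 2)"
  using threshold_lowerable_many_choices threshold_lowerable_two_choices eventually_large_k
  by (auto simp: eventually_at_top_linorder)

end
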